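(* The Scott topology on $2^\omega$ is not homeomorphic to $\mathcal{ALG}_0/\!\cong$; nor is $2^\omega/\!=^f$ homeomorphic to $\mathcal{ALG}_0/\!\cong$.
   Context: The Scott topology on $2^\omega$ has as basic open sets $\mathcal{W}_F=\{h\in2^\omega: F\subseteq h^{-1}(1)\}$ for finite $F\subseteq\omega$. Fix a computable pairing bijection $\langle\cdot,\cdot\rangle:\omega^2\to\omega$; for $A\subseteq\omega$ let $A^{[x]}=\{y:\langle x,y\rangle\in A\}$, and define $A=^fB$ iff $|A^{[x]}|=|B^{[x]}|$ for all $x$ (cardinalities in $\omega\cup\{\omega\}$); $2^\omega/\!=^f$ carries the quotient topology from Cantor space. $\mathcal{ALG}_0\subseteq 2^\omega$ is the set of atomic diagrams (fixed effective Gödel coding) of fields with domain $\omega$, in the language of fields (no extra predicates), algebraic over $\mathbb{Q}$; it has the subspace topology from Cantor space, and $\mathcal{ALG}_0/\!\cong$ (isomorphism classes of these fields) has the quotient topology. *)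

theory Defs
  imports
    "HOL-Analysis.Function_Topology"
    "HOL-Algebra.Finite_Extensions"
    "HOL-Library.Equipollence"
    "HOL-Library.Nat_Bijection"
begin

section \<open>Topologies on Cantor space and quotients\<close>

text \<open>Elements of \<open>2\<^sup>\<omega>\<close> are functions \<open>nat \<Rightarrow> bool\<close>, with \<open>True\<close> in the role of \<open>1\<close>.\<close>

definition cantor_space :: "(nat \<Rightarrow> bool) topology" where
  "cantor_space = product_topology (\<lambda>_. discrete_topology UNIV) UNIV"

definition scott_basic :: "nat set \<Rightarrow> (nat \<Rightarrow> bool) set" where
  "scott_basic F = {h. F \<subseteq> h -` {True}}"

definition scott_topology :: "(nat \<Rightarrow> bool) topology" where
  "scott_topology = topology_generated_by {scott_basic F |F. finite F}"

definition quotient_topology :: "'a topology \<Rightarrow> ('a \<times> 'a) set \<Rightarrow> 'a set topology" where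
  "quotient_topology T r = topology (\<lambda>U. U \<subseteq> topspace T // r \<and> openin T (\<Union>U))"

text \<open>The sets \<open>scott_basic F\<close> are closed under finite intersections, so they are not merely
  a subbase but a base.\<close>

lemma openin_scott_topology:
  "openin scott_topology U \<longleftrightarrow>
    (\<forall>h\<in>U. \<exists>F. finite F \<and> h \<in> scott_basic F \<and> scott_basic F \<subseteq> U)"
proof
  assume "openin scott_topology U"
  then have "generate_topology_on {scott_basic F |F. finite F} U"
    by (simp add: scott_topology_def openin_topology_generated_by_iff)
  then show "\<forall>h\<in>U. \<exists>F. finite F \<and> h \<in> scott_basic F \<and> scott_basic F \<subseteq> U"
  proof (induction rule: generate_topology_on.induct)
    case (Int a b)
    show ?case
    proof
      fix h assume "h \<in> a \<inter> b"
      then obtain F G where "finite F" "h \<in> scott_basic F" "scott_basic F \<subseteq> a"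
        "finite G" "h \<in> scott_basic G" "scott_basic G \<subseteq> b"
        using Int.IH by blast
      then have "finite (F \<union> G) \<and> h \<in> scott_basic (F \<union> G) \<and> scott_basic (F \<union> G) \<subseteq> a \<inter> b"
        by (auto simp: scott_basic_def)
      then show "\<exists>F. finite F \<and> h \<in> scott_basic F \<and> scott_basic F \<subseteq> a \<inter> b" by blast
    qed
  next
    case (UN K)
    then show ?case by (meson UnionE Union_upper order_trans)
  qed auto
next
  assume *: "\<forall>h\<in>U. \<exists>F. finite F \<and> h \<in> scott_basic F \<and> scott_basic F \<subseteq> U"
  show "openin scott_topology U"
  proof (subst openin_subopen, intro ballI)
    fix h assume "h \<in> U"
    with * obtain F where "finite F" "h \<in> scott_basic F" "scott_basic F \<subseteq> U" by blast
    then show "\<exists>T. openin scott_topology T \<and> h \<in> T \<and> T \<subseteq> U"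
      unfolding scott_topology_def
      by (intro exI[of _ "scott_basic F"] conjI topology_generated_by_Basis) auto
  qed
qed

lemma istopology_quotient:
  assumes "equiv (topspace T) r"
  shows "istopology (\<lambda>U. U \<subseteq> topspace T // r \<and> openin T (\<Union>U))"
proof -
  have Int: "\<Union>(S \<inter> V) = \<Union>S \<inter> \<Union>V" if "S \<subseteq> topspace T // r" "V \<subseteq> topspace T // r" for S V
  proof -
    have "A = B" if "A \<in> S" "B \<in> V" "x \<in> A" "x \<in> B" for A B x
    proof -
      have "A \<in> topspace T // r" "B \<in> topspace T // r"
        using that \<open>S \<subseteq> topspace T // r\<close> \<open>V \<subseteq> topspace T // r\<close> by (auto dest: subsetD)
      then show ?thesis using quotient_disj[OF assms, of A B] that by auto
    qed
    note eq = this
    show ?thesis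
    proof
      show "\<Union>S \<inter> \<Union>V \<subseteq> \<Union>(S \<inter> V)"
      proof
        fix x assume "x \<in> \<Union>S \<inter> \<Union>V"
        then obtain A B where AB: "A \<in> S" "B \<in> V" "x \<in> A" "x \<in> B" by auto
        with eq[OF AB] show "x \<in> \<Union>(S \<inter> V)" by auto
      qed
    qed auto
  qed
  have Un: "openin T (\<Union>(\<Union>K))" if "\<And>S. S \<in> K \<Longrightarrow> openin T (\<Union>S)" for K
  proof -
    have "\<Union>(\<Union>K) = (\<Union>S\<in>K. \<Union>S)" by blast
    then show ?thesis using that by auto
  qed
  show ?thesis
    unfolding istopology_def
  proof (intro conjI allI impI)
    fix S V
    assume S: "S \<subseteq> topspace T // r \<and> openin T (\<Union>S)" and V: "V \<subseteq> topspace T // r \<and> openin T (\<Union>V)"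
    show "S \<inter> V \<subseteq> topspace T // r" using S by blast
    show "openin T (\<Union>(S \<inter> V))" using S V Int by (simp add: openin_Int)
  next
    fix K assume "\<forall>S\<in>K. S \<subseteq> topspace T // r \<and> openin T (\<Union>S)"
    then show "\<Union>K \<subseteq> topspace T // r" "openin T (\<Union>(\<Union>K))" using Un by blast+
  qed
qed

lemma openin_quotient_topology:
  assumes "equiv (topspace T) r"
  shows "openin (quotient_topology T r) U \<longleftrightarrow> U \<subseteq> topspace T // r \<and> openin T (\<Union>U)"
  unfolding quotient_topology_def topology_inverse'[OF istopology_quotient[OF assms]] ..

lemma topspace_quotient_topology:
  assumes "equiv (topspace T) r"
  shows "topspace (quotient_topology T r) = topspace T // r"
  unfolding topspace_def[of "quotient_topology T r"] openin_quotient_topology[OF assms]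
  using Union_quotient[OF assms] by auto

lemma quotient_map_quotient_topology:
  assumes "equiv (topspace T) r"
  shows "quotient_map T (quotient_topology T r) (\<lambda>x. r `` {x})"
proof -
  have "{x \<in> topspace T. r `` {x} \<in> U} = \<Union>U" if U: "U \<subseteq> topspace T // r" for U
  proof (intro Set.set_eqI iffI)
    fix x assume "x \<in> {x \<in> topspace T. r `` {x} \<in> U}"
    then show "x \<in> \<Union>U" using equiv_class_self[OF assms] by blast
  next
    fix x assume "x \<in> \<Union>U"
    then obtain C where C: "C \<in> U" "x \<in> C" by blast
    then obtain y where "C = r `` {y}" "y \<in> topspace T" using U by (meson quotientE subsetD)
    with C have "(y, x) \<in> r" by simp
    then have "x \<in> topspace T" "r `` {y} = r `` {x}"
      using equiv_class_eq_iff[OF assms, of y x] by simp_all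
    with \<open>C = r `` {y}\<close> have "x \<in> topspace T" "r `` {x} = C" by simp_all
    then show "x \<in> {x \<in> topspace T. r `` {x} \<in> U}" using C by simp
  qed
  then show ?thesis
    unfolding quotient_map_def topspace_quotient_topology[OF assms]
    by (auto simp: openin_quotient_topology[OF assms] quotient_def)
qed

section \<open>The relation \<open>=\<^sup>f\<close>\<close>

text \<open>The pairing bijection is Cantor's, \<^const>\<open>prod_encode\<close>.  Subsets of \<open>\<omega>\<close> have
  cardinalities in \<open>\<omega> \<union> {\<omega>}\<close>, so equality of these is equipollence.\<close>

definition column :: "(nat \<Rightarrow> bool) \<Rightarrow> nat \<Rightarrow> nat set" where
  "column A x = {y. A (prod_encode (x, y))}"

definition eqf :: "((nat \<Rightarrow> bool) \<times> (nat \<Rightarrow> bool)) set" where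
  "eqf = {(A, B). \<forall>x. column A x \<approx> column B x}"

lemma equiv_eqf: "equiv UNIV eqf"
proof (rule equivI)
  show "sym eqf" unfolding eqf_def by (rule symI) (simp add: eqpoll_sym)
  show "trans eqf" unfolding eqf_def by (rule transI) (simp, meson eqpoll_trans)
qed (simp_all add: eqf_def refl_on_def)

section \<open>Atomic diagrams of algebraic fields\<close>

text \<open>Closed terms in the language \<open>0, 1, +, \<cdot>\<close> of fields, expanded by a constant symbol
  for every element of the domain \<open>\<omega>\<close>.\<close>

datatype fterm = Elem nat | Zero | One | Plus fterm fterm | Times fterm fterm

datatype atomic_sentence = Eq fterm fterm

primrec term_code :: "fterm \<Rightarrow> nat" where
  "term_code Zero = 0"
| "term_code One = 1"
| "term_code (Elem a) = 3 * a + 2"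
| "term_code (Plus s t) = 3 * prod_encode (term_code s, term_code t) + 3"
| "term_code (Times s t) = 3 * prod_encode (term_code s, term_code t) + 4"

primrec sentence_code :: "atomic_sentence \<Rightarrow> nat" where
  "sentence_code (Eq s t) = prod_encode (term_code s, term_code t)"

primrec term_val :: "nat ring \<Rightarrow> fterm \<Rightarrow> nat" where
  "term_val R Zero = \<zero>\<^bsub>R\<^esub>"
| "term_val R One = \<one>\<^bsub>R\<^esub>"
| "term_val R (Elem a) = a"
| "term_val R (Plus s t) = term_val R s \<oplus>\<^bsub>R\<^esub> term_val R t"
| "term_val R (Times s t) = term_val R s \<otimes>\<^bsub>R\<^esub> term_val R t"

primrec holds :: "nat ring \<Rightarrow> atomic_sentence \<Rightarrow> bool" where
  "holds R (Eq s t) \<longleftrightarrow> term_val R s = term_val R t"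

definition atomic_diagram :: "nat ring \<Rightarrow> nat \<Rightarrow> bool" where
  "atomic_diagram R n \<longleftrightarrow> (\<exists>\<phi>. sentence_code \<phi> = n \<and> holds R \<phi>)"

definition rat_ring :: "rat ring" where
  "rat_ring = \<lparr>carrier = UNIV, mult = (*), one = 1, zero = 0, add = (+)\<rparr>"

text \<open>A ring homomorphism from \<open>\<rat>\<close> into a field is an embedding, and there is at most one.\<close>

definition alg_field :: "nat ring \<Rightarrow> bool" where
  "alg_field R \<longleftrightarrow> field R \<and> carrier R = UNIV \<and>
    (\<exists>\<iota> \<in> ring_hom rat_ring R. \<forall>x\<in>carrier R. (ring.algebraic R over range \<iota>) x)"

definition ALG0 :: "(nat \<Rightarrow> bool) set" where
  "ALG0 = {atomic_diagram R |R. alg_field R}"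

definition ALG0_iso :: "((nat \<Rightarrow> bool) \<times> (nat \<Rightarrow> bool)) set" where
  "ALG0_iso = {(atomic_diagram R, atomic_diagram S) |R S. alg_field R \<and> alg_field S \<and> R \<simeq> S}"

definition eqf_space :: "(nat \<Rightarrow> bool) set topology" where
  "eqf_space = quotient_topology cantor_space eqf"

definition ALG0_space :: "(nat \<Rightarrow> bool) set topology" where
  "ALG0_space = quotient_topology (subtopology cantor_space ALG0) ALG0_iso"

lemma inj_term_code: "term_code s = term_code t \<Longrightarrow> s = t"
proof (induction s arbitrary: t)
  case (Elem a) then show ?case by (cases t) (simp_all, presburger+)
next
  case Zero then show ?case by (cases t) simp_all
next
  case One then show ?case by (cases t) simp_all
next
  case (Plus s1 s2) then show ?case by (cases t) (simp_all, presburger+)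
next
  case (Times s1 s2) then show ?case by (cases t) (simp_all, presburger+)
qed

lemma surj_term_code: "\<exists>t. term_code t = n"
proof (induction n rule: less_induct)
  case (less n)
  have pair: "\<exists>s t. prod_encode (term_code s, term_code t) = m" if "m < n" for m
  proof -
    obtain a b where ab: "m = prod_encode (a, b)" by (metis prod_decode_inverse surj_pair)
    then have "a < n" "b < n"
      using that le_prod_encode_1[of a b] le_prod_encode_2[of b a] by auto
    then show ?thesis using less ab by metis
  qed
  consider "n = 0" | "n = 1" | a where "n = 3 * a + 2"
    | a where "n = 3 * a + 3" | a where "n = 3 * a + 4"
  proof -
    have "n = 0 \<or> n = 1 \<or> (\<exists>a. n = 3 * a + 2) \<or> (\<exists>a. n = 3 * a + 3) \<or> (\<exists>a. n = 3 * a + 4)"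
      by presburger
    then show thesis using that by blast
  qed
  then show ?case
  proof cases
    case 1 then show ?thesis by (metis term_code.simps(1))
  next
    case 2 then show ?thesis by (metis term_code.simps(2))
  next
    case 3 then show ?thesis by (metis term_code.simps(3))
  next
    case (4 a)
    then obtain s t where "prod_encode (term_code s, term_code t) = a" using pair[of a] by auto
    with 4 have "term_code (Plus s t) = n" by simp
    then show ?thesis ..
  next
    case (5 a)
    then obtain s t where "prod_encode (term_code s, term_code t) = a" using pair[of a] by auto
    with 5 have "term_code (Times s t) = n" by simp
    then show ?thesis ..
  qed
qed

lemma bij_sentence_code: "bij sentence_code"
proof (rule bijI)
  show "inj sentence_code"
  proof (rule injI)
    fix x y assume "sentence_code x = sentence_code y"
    then show "x = y" by (cases x; cases y) (simp add: inj_term_code)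
  qed
  have "\<exists>\<phi>. sentence_code \<phi> = n" for n
  proof -
    obtain a b where "n = prod_encode (a, b)" by (metis prod_decode_inverse surj_pair)
    then show ?thesis using surj_term_code by (metis sentence_code.simps)
  qed
  then show "surj sentence_code" by (simp add: surj_def) metis
qed

lemma atomic_diagram_sentence_code: "atomic_diagram R (sentence_code \<phi>) \<longleftrightarrow> holds R \<phi>"
  unfolding atomic_diagram_def using inj_eq[OF bij_is_inj[OF bij_sentence_code]] by simp

lemma atomic_diagram_inj:
  assumes "carrier R = carrier S" and eq: "atomic_diagram R = atomic_diagram S"
  shows "R = S"
proof -
  have h: "holds R \<phi> = holds S \<phi>" for \<phi>
    using eq atomic_diagram_sentence_code by metis
  have "\<zero>\<^bsub>R\<^esub> = \<zero>\<^bsub>S\<^esub>" "\<one>\<^bsub>R\<^esub> = \<one>\<^bsub>S\<^esub>"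
    using h[of "Eq Zero (Elem \<zero>\<^bsub>R\<^esub>)"] h[of "Eq One (Elem \<one>\<^bsub>R\<^esub>)"] by simp_all
  moreover have "a \<oplus>\<^bsub>R\<^esub> b = a \<oplus>\<^bsub>S\<^esub> b" "a \<otimes>\<^bsub>R\<^esub> b = a \<otimes>\<^bsub>S\<^esub> b" for a b
    using h[of "Eq (Plus (Elem a) (Elem b)) (Elem (a \<oplus>\<^bsub>R\<^esub> b))"]
      h[of "Eq (Times (Elem a) (Elem b)) (Elem (a \<otimes>\<^bsub>R\<^esub> b))"] by simp_all
  then have "add R = add S" "mult R = mult S" by (intro ext; simp)+
  ultimately show ?thesis using assms(1) by (cases R; cases S) auto
qed

lemma equiv_ALG0_iso: "equiv ALG0 ALG0_iso"
proof (rule equivI)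
  show "ALG0_iso \<subseteq> ALG0 \<times> ALG0" by (auto simp: ALG0_iso_def ALG0_def)
  show "refl_on ALG0 ALG0_iso"
    by (auto simp: refl_on_def ALG0_iso_def ALG0_def intro: ring_iso_refl)
  show "sym ALG0_iso"
  proof (rule symI)
    fix D E assume "(D, E) \<in> ALG0_iso"
    then obtain R S where "D = atomic_diagram R" "E = atomic_diagram S"
      "alg_field R" "alg_field S" "R \<simeq> S" by (auto simp: ALG0_iso_def)
    moreover from this have "S \<simeq> R"
      using ring_iso_sym field.is_ring unfolding alg_field_def by blast
    ultimately show "(E, D) \<in> ALG0_iso" by (auto simp: ALG0_iso_def)
  qed
  show "trans ALG0_iso"
  proof (rule transI)
    fix D E F assume "(D, E) \<in> ALG0_iso" "(E, F) \<in> ALG0_iso"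
    then obtain R S S' T where *: "D = atomic_diagram R" "E = atomic_diagram S"
      "E = atomic_diagram S'" "F = atomic_diagram T"
      "alg_field R" "alg_field S" "alg_field S'" "alg_field T" "R \<simeq> S" "S' \<simeq> T"
      by (auto simp: ALG0_iso_def)
    then have "S = S'" by (metis atomic_diagram_inj alg_field_def)
    with * have "R \<simeq> T" using ring_iso_trans by blast
    with * show "(D, F) \<in> ALG0_iso" by (auto simp: ALG0_iso_def)
  qed
qed

end

theory Submission
  imports Defs "HOL-Algebra.Weak_Morphisms"
begin

text \<open>The two spaces are separated from \<open>ALG\<^sub>0/\<cong>\<close> by their specialization orders.  For the Scott
  topology this order is inclusion, and for \<open>2\<^sup>\<omega>/=\<^sup>f\<close> it compares the cardinalities of all columns; both
  are distributive lattices, in which \<open>c \<le> a \<squnion> b\<close>, \<open>a \<sqinter> c = \<bottom>\<close> and \<open>b \<sqinter> c = \<bottom>\<close> imply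
  \<open>c = \<bottom>\<close>.  For fields the order is embeddability of finite partial structures, and
  \<open>\<rat>(\<surd>-1)\<close>, \<open>\<rat>(\<surd>2)\<close>, \<open>\<rat>(\<surd>-2)\<close> violate this law: a field containing roots of \<open>-1\<close> and \<open>2\<close>
  contains a root of \<open>-2\<close>, while two different quadratic fields share only \<open>\<rat>\<close>.\<close>

section \<open>Distributivity of the specialization order\<close>

text \<open>\<open>specializes T x y\<close> says that \<open>x\<close> lies in the closure of
  \<open>y\<close>, so open sets are upward closed and any homeomorphism preserves the relation. In
  both quotients it can be decided on finite parts of codes: every finite part of a code of
  \<open>x\<close> has to occur in some code of \<open>y\<close>. On the field side such finite
  parts only give maps of finitely many elements, which change with the part, and not an embedding
  of fields. Instead of gluing them, the proof extracts two finite consequences: a square root of a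
  given rational in the target, and, when the target is quadratic, an equation
  \<open>(y - p)^2 = n q^2\<close> with rational \<open>p\<close> and \<open>q\<close>. Both need
  the partial maps to respect the rationals, which is achieved by sentences that define each
  rational without naming other elements. The numbers are chosen so that
  \<open>(-1) * 2 = -2\<close>, while neither \<open>(-1) / (-2)\<close> nor \<open>2 / (-2)\<close>
  is a rational square.\<close>

definition specializes :: "'a topology \<Rightarrow> 'a \<Rightarrow> 'a \<Rightarrow> bool" where
  "specializes T x y \<longleftrightarrow> (\<forall>U. openin T U \<longrightarrow> x \<in> U \<longrightarrow> y \<in> U)"

definition least_point :: "'a topology \<Rightarrow> 'a \<Rightarrow> bool" where
  "least_point T x \<longleftrightarrow> (\<forall>y\<in>topspace T. specializes T x y)"

text \<open>Plays the role of a meet equal to bottom, but through lower bounds, since meets are not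
  assumed to exist.\<close>

definition disjoint_points :: "'a topology \<Rightarrow> 'a \<Rightarrow> 'a \<Rightarrow> bool" where
  "disjoint_points T x y \<longleftrightarrow>
    (\<forall>z\<in>topspace T. specializes T z x \<and> specializes T z y \<longrightarrow> least_point T z)"

text \<open>The upper bound condition expresses \<open>c \<le> a \<squnion> b\<close> without assuming that joins exist.\<close>

definition distributive_space :: "'a topology \<Rightarrow> bool" where
  "distributive_space T \<longleftrightarrow> (\<forall>a\<in>topspace T. \<forall>b\<in>topspace T. \<forall>c\<in>topspace T.
    (\<forall>u\<in>topspace T. specializes T a u \<and> specializes T b u \<longrightarrow> specializes T c u) \<longrightarrow>
    disjoint_points T a c \<longrightarrow> disjoint_points T b c \<longrightarrow> least_point T c)"

lemma specializes_homeomorphic_map: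
  assumes "homeomorphic_map S T f" "x \<in> topspace S" "y \<in> topspace S"
  shows "specializes T (f x) (f y) \<longleftrightarrow> specializes S x y"
proof
  have inj: "inj_on f (topspace S)" and op: "open_map S T f" and cont: "continuous_map S T f"
    using assms(1) by (auto simp: homeomorphic_eq_everything_map)
  show "specializes S x y" if "specializes T (f x) (f y)"
    unfolding specializes_def
  proof (intro allI impI)
    fix U assume U: "openin S U" "x \<in> U"
    then have "f y \<in> f ` U"
      using that op unfolding specializes_def open_map_def by blast
    then show "y \<in> U"
      using inj assms(3) openin_subset[OF U(1)] by (auto dest: inj_onD)
  qed
  show "specializes T (f x) (f y)" if "specializes S x y"
    unfolding specializes_def
  proof (intro allI impI)
    fix U assume U: "openin T U" "f x \<in> U"
    then have "openin S {z \<in> topspace S. f z \<in> U}"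
      using cont by (simp add: openin_continuous_map_preimage)
    then show "f y \<in> U"
      using that U assms(2) unfolding specializes_def by blast
  qed
qed

text \<open>The law is built from \<open>specializes\<close> and \<open>topspace\<close> alone, and
  a homeomorphism carries both along.\<close>

lemma distributive_space_homeomorphic:
  assumes "S homeomorphic_space T" "distributive_space S"
  shows "distributive_space T"
proof -
  obtain f where f: "homeomorphic_map S T f"
    using assms(1) homeomorphic_space by blast
  have top: "topspace T = f ` topspace S"
    using f by (auto simp: homeomorphic_eq_everything_map)
  note sp = specializes_homeomorphic_map[OF f]
  have least: "least_point T (f x) \<longleftrightarrow> least_point S x" if "x \<in> topspace S" for x
    using that by (simp add: least_point_def top sp)
  have disj: "disjoint_points T (f x) (f y) \<longleftrightarrow> disjoint_points S x y"
    if "x \<in> topspace S" "y \<in> topspace S" for x y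
    using that by (simp add: disjoint_points_def top sp least)
  show ?thesis
    using assms(2) by (simp add: distributive_space_def top sp disj least)
qed

section \<open>The Scott order is inclusion\<close>

lemma specializes_scott_topology: "specializes scott_topology g h \<longleftrightarrow> g \<le> h"
proof
  assume *: "specializes scott_topology g h"
  show "g \<le> h"
  proof (intro le_funI le_boolI)
    fix i assume "g i"
    moreover have "openin scott_topology (scott_basic {i})"
      unfolding scott_topology_def by (intro topology_generated_by_Basis) auto
    ultimately show "h i"
      using * unfolding specializes_def by (auto simp: scott_basic_def)
  qed
next
  assume gh: "g \<le> h"
  show "specializes scott_topology g h"
    unfolding specializes_def
  proof (intro allI impI)
    fix U assume "openin scott_topology U" "g \<in> U"
    then obtain F where "g \<in> scott_basic F" "scott_basic F \<subseteq> U"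
      by (auto simp: openin_scott_topology)
    with gh show "h \<in> U" by (force simp: scott_basic_def le_fun_def)
  qed
qed

lemma topspace_scott_topology [simp]: "topspace scott_topology = UNIV"
  using openin_subset[of scott_topology UNIV]
  by (auto simp: openin_scott_topology scott_basic_def)

lemma distributive_space_scott: "distributive_space scott_topology"
proof -
  have "c = bot" if ub: "\<And>u. a \<le> u \<Longrightarrow> b \<le> u \<Longrightarrow> c \<le> u"
    and a: "\<And>d e. d \<le> a \<Longrightarrow> d \<le> c \<Longrightarrow> d \<le> e" and b: "\<And>d e. d \<le> b \<Longrightarrow> d \<le> c \<Longrightarrow> d \<le> e"
    for a b c :: "nat \<Rightarrow> bool"
  proof -
    have "c \<le> sup a b" using ub by simp
    moreover have "inf a c = bot" "inf b c = bot"
      using a[of "inf a c" bot] b[of "inf b c" bot] by (simp_all add: bot_unique)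
    \<comment> \<open>Distributivity:
      \<open>c = inf (sup a b) c = sup (inf a c) (inf b c) = bot\<close>.\<close>
    ultimately show ?thesis by (metis inf.absorb2 inf_sup_distrib2 sup_bot.right_neutral)
  qed
  then show ?thesis
    unfolding distributive_space_def disjoint_points_def least_point_def specializes_scott_topology
    by (metis UNIV_I bot_least topspace_scott_topology)
qed

section \<open>Neighbourhoods in Cantor space\<close>

lemma topspace_cantor_space [simp]: "topspace cantor_space = UNIV"
  by (simp add: cantor_space_def)

lemma openin_cantor_space:
  "openin cantor_space U \<longleftrightarrow> (\<forall>g\<in>U. \<exists>N. finite N \<and> (\<forall>h. (\<forall>i\<in>N. h i = g i) \<longrightarrow> h \<in> U))"
proof -
  have "(\<exists>V. finite {i. V i \<noteq> UNIV} \<and> g \<in> Pi UNIV V \<and> Pi UNIV V \<subseteq> U) \<longleftrightarrow>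
        (\<exists>N. finite N \<and> (\<forall>h. (\<forall>i\<in>N. h i = g i) \<longrightarrow> h \<in> U))" (is "?L \<longleftrightarrow> ?R")
    for g :: "nat \<Rightarrow> bool"
  proof
    assume ?L
    then obtain V where V: "finite {i. V i \<noteq> UNIV}" "g \<in> Pi UNIV V" "Pi UNIV V \<subseteq> U" by blast
    have "h \<in> U" if "\<forall>i\<in>{i. V i \<noteq> UNIV}. h i = g i" for h
      
    proof -
      have "h i \<in> V i" for i using that V(2) by (cases "V i = UNIV") (auto simp: Pi_iff)
      then have "h \<in> Pi UNIV V" by simp
      then show ?thesis using V(3) by blast
    qed
    with V(1) show ?R by blast
  next
    assume ?R
    then obtain N where N: "finite N" "\<And>h. (\<forall>i\<in>N. h i = g i) \<Longrightarrow> h \<in> U" by blast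
    let ?V = "\<lambda>i. if i \<in> N then {g i} else UNIV"
    have "finite {i. ?V i \<noteq> UNIV}" by (rule finite_subset[OF _ N(1)]) auto
    moreover have "h \<in> U" if "h \<in> Pi UNIV ?V" for h
    proof (intro N(2) ballI)
      fix i assume "i \<in> N"
      moreover have "h i \<in> ?V i" using that by blast
      ultimately show "h i = g i" by simp
    qed
    ultimately show ?L by (intro exI[of _ ?V]) auto
  qed
  then show ?thesis
    by (simp add: cantor_space_def openin_product_topology_alt PiE_UNIV_domain)
qed

lemma openin_cantor_spaceE:
  assumes "openin cantor_space U" "g \<in> U"
  obtains N where "finite N" "\<And>h. (\<forall>i\<in>N. h i = g i) \<Longrightarrow> h \<in> U"
proof -
  obtain N where "finite N \<and> (\<forall>h. (\<forall>i\<in>N. h i = g i) \<longrightarrow> h \<in> U)"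
    using bspec[OF assms(1)[unfolded openin_cantor_space] assms(2)] ..
  then show thesis by (intro that[of N]) simp_all
qed

section \<open>The specialization order of \<open>2\<^sup>\<omega>/=\<^sup>f\<close>\<close>

lemma eqpoll_infinite_nat:
  fixes S T :: "nat set"
  assumes "infinite S" "infinite T"
  shows "S \<approx> T"
proof -
  have "(UNIV :: nat set) \<approx> S" "(UNIV :: nat set) \<approx> T"
    unfolding eqpoll_def using bij_enumerate assms by blast+
  then show ?thesis by (meson eqpoll_sym eqpoll_trans)
qed

lemma lepoll_nat_iff:
  fixes S T :: "nat set"
  shows "S \<lesssim> T \<longleftrightarrow> (finite T \<longrightarrow> finite S \<and> card S \<le> card T)"
proof (cases "finite T")
  case True
  then show ?thesis
    unfolding lepoll_def by (metis inj_on_finite inj_on_iff_card_le)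
next
  case False
  then have "(UNIV :: nat set) \<approx> T" by (intro eqpoll_infinite_nat) auto
  then have "S \<lesssim> T"
    using lepoll_trans2 subset_imp_lepoll[OF subset_UNIV] by blast
  with False show ?thesis by simp
qed

text \<open>Comparability is what turns the case distinctions in
  \<open>distributive_space_eqf\<close> into columnwise minima and maxima.\<close>

lemma not_lepoll_natD:
  fixes S T :: "nat set"
  shows "\<not> S \<lesssim> T \<Longrightarrow> T \<lesssim> S"
  by (auto simp: lepoll_nat_iff)

text \<open>Inside \<open>N\<close> the set copies \<open>S\<close>; outside \<open>N\<close> there
  is always room for the elements still missing to reach the size of \<open>T\<close>.\<close>

lemma exists_eqpoll_agreeing:
  fixes S T N :: "nat set"
  assumes "S \<lesssim> T" "finite N"
  shows "\<exists>Z. Z \<approx> T \<and> (\<forall>y\<in>N. y \<in> Z \<longleftrightarrow> y \<in> S)"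
proof (cases "finite T")
  case True
  then have XN: "card (S \<inter> N) \<le> card T"
    using assms by (metis card_mono inf_le1 le_trans lepoll_nat_iff)
  obtain G where G: "finite G" "card G = card T - card (S \<inter> N)" "G \<subseteq> UNIV - N"
    using infinite_arbitrarily_large[of "UNIV - N"] assms(2) by auto
  have "card (S \<inter> N \<union> G) = card T"
    using G XN assms(2) by (subst card_Un_disjoint) auto
  then have "S \<inter> N \<union> G \<approx> T"
    using True G assms(2) by (simp add: eqpoll_iff_card)
  then show ?thesis using G(3) by (intro exI[of _ "S \<inter> N \<union> G"]) auto
next
  case False
  have "S \<inter> N \<union> (UNIV - N) \<approx> T"
    using False assms(2) by (intro eqpoll_infinite_nat) auto
  then show ?thesis by (intro exI[of _ "S \<inter> N \<union> (UNIV - N)"]) auto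
qed

definition of_columns :: "(nat \<Rightarrow> nat set) \<Rightarrow> nat \<Rightarrow> bool" where
  "of_columns C n = (case prod_decode n of (x, y) \<Rightarrow> y \<in> C x)"

lemma column_of_columns [simp]: "column (of_columns C) x = C x"
  by (simp add: column_def of_columns_def)

lemma openin_eqf_space:
  "openin eqf_space U \<longleftrightarrow> U \<subseteq> UNIV // eqf \<and> openin cantor_space (\<Union>U)"
  unfolding eqf_space_def by (simp add: openin_quotient_topology equiv_eqf)

lemma topspace_eqf_space: "topspace eqf_space = UNIV // eqf"
  unfolding eqf_space_def by (simp add: topspace_quotient_topology equiv_eqf)

text \<open>Having at least \<open>k\<close> elements in a column is witnessed by finitely many
  positive bits, hence open. An upper bound on the size is not open, since elements can be added
  beyond any finite set of bits; so the order only allows columns to grow.\<close>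

lemma specializes_eqf_space:
  "specializes eqf_space (eqf `` {A}) (eqf `` {B}) \<longleftrightarrow> (\<forall>x. column A x \<lesssim> column B x)"
proof
  assume *: "specializes eqf_space (eqf `` {A}) (eqf `` {B})"
  have fin: "F \<lesssim> column B x" if F: "finite F" "F \<lesssim> column A x" for F :: "nat set" and x
  proof -
    define W where "W = {C. F \<lesssim> column C x}"
    \<comment> \<open>Invariance under \<open>eqf\<close> makes \<open>W\<close> the union of the
      classes that meet it, so that it is open in the quotient.\<close>
    have sat: "C \<in> W \<longleftrightarrow> D \<in> W" if "(C, D) \<in> eqf" for C D
    proof -
      have "column C x \<approx> column D x" using that by (simp add: eqf_def)
      then show ?thesis
        unfolding W_def by (metis eqpoll_sym lepoll_trans2 mem_Collect_eq)
    qed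
    define U where "U = {eqf `` {C} |C. C \<in> W}"
    have Un: "\<Union>U = W"
    proof (intro equalityI subsetI)
      show "C \<in> W" if "C \<in> \<Union>U" for C using that sat by (auto simp: U_def)
      show "C \<in> \<Union>U" if "C \<in> W" for C
        using that equiv_class_self[OF equiv_eqf, of C] by (auto simp: U_def)
    qed
    have "openin cantor_space W"
      unfolding openin_cantor_space
    proof
      fix C assume "C \<in> W"
      then obtain f where f: "inj_on f F" "f ` F \<subseteq> column C x"
        by (auto simp: W_def lepoll_def)
      then have G: "f ` F \<subseteq> column C x" "F \<approx> f ` F"
        by (simp_all add: eqpoll_sym inj_on_image_eqpoll_self)
      have "finite (f ` F)" using F(1) by simp
      moreover have "h \<in> W" if "\<forall>i\<in>(\<lambda>y. prod_encode (x, y)) ` f ` F. h i = C i" for h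
      proof -
        have "f ` F \<subseteq> column h x" using that G(1) by (auto simp: column_def)
        then show ?thesis
          unfolding W_def using G(2) by (simp add: eqpoll_imp_lepoll lepoll_trans1 subset_imp_lepoll)
      qed
      ultimately show "\<exists>N. finite N \<and> (\<forall>h. (\<forall>i\<in>N. h i = C i) \<longrightarrow> h \<in> W)"
        by (intro exI[of _ "(\<lambda>y. prod_encode (x, y)) ` f ` F"]) auto
    qed
    then have "openin eqf_space U"
      unfolding openin_eqf_space Un by (auto simp: U_def quotient_def)
    moreover have "eqf `` {A} \<in> U" using F by (auto simp: U_def W_def)
    ultimately have "eqf `` {B} \<in> U" using * by (auto simp: specializes_def)
    then have "B \<in> W" using Un equiv_class_self[OF equiv_eqf, of B] by auto
    then show ?thesis by (simp add: W_def)
  qed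
  show "\<forall>x. column A x \<lesssim> column B x"
  proof
    fix x
    show "column A x \<lesssim> column B x"
    proof (cases "finite (column A x)")
      case False
      have "infinite (column B x)"
      proof
        assume B: "finite (column B x)"
        \<comment> \<open>\<open>fin\<close> tests finite sizes only; one element more than the
          finite column of \<open>B\<close> suffices for a contradiction.\<close>
        obtain F where F: "F \<subseteq> column A x" "finite F" "card F = Suc (card (column B x))"
          using infinite_arbitrarily_large[OF False] by blast
        then have "F \<lesssim> column B x" using fin subset_imp_lepoll by blast
        with B F show False by (simp add: lepoll_nat_iff)
      qed
      then show ?thesis by (simp add: lepoll_nat_iff)
    qed (auto intro: fin)
  qed
next
  assume *: "\<forall>x. column A x \<lesssim> column B x"
  show "specializes eqf_space (eqf `` {A}) (eqf `` {B})"
    unfolding specializes_def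
  proof (intro allI impI)
    fix U assume U: "openin eqf_space U" "eqf `` {A} \<in> U"
    have "openin cantor_space (\<Union>U)" using U(1) by (simp add: openin_eqf_space)
    moreover have "A \<in> \<Union>U" using U(2) equiv_class_self[OF equiv_eqf, of A] by auto
    ultimately obtain N where N: "finite N" "\<And>h. (\<forall>i\<in>N. h i = A i) \<Longrightarrow> h \<in> \<Union>U"
      by (rule openin_cantor_spaceE) blast
    have "finite {y. prod_encode (x, y) \<in> N}" for x
      using finite_vimageI[OF N(1), of "\<lambda>y. prod_encode (x, y)"]
      by (simp add: inj_on_def vimage_def)
    \<comment> \<open>\<open>N\<close> fixes only finitely many bits of each column, so the columns
      can be completed to the sizes required by \<open>B\<close> independently.\<close>
    then have "\<exists>Z. Z \<approx> column B x \<and> (\<forall>y\<in>{y. prod_encode (x, y) \<in> N}. y \<in> Z \<longleftrightarrow> y \<in> column A x)"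
      for x using exists_eqpoll_agreeing * by blast
    then obtain Z where Z: "\<And>x. Z x \<approx> column B x"
      "\<And>x y. prod_encode (x, y) \<in> N \<Longrightarrow> y \<in> Z x \<longleftrightarrow> y \<in> column A x"
    proof -
      assume thesis: "\<And>Z. (\<And>x. Z x \<approx> column B x) \<Longrightarrow>
        (\<And>x y. prod_encode (x, y) \<in> N \<Longrightarrow> y \<in> Z x \<longleftrightarrow> y \<in> column A x) \<Longrightarrow> thesis"
      assume "\<And>x. \<exists>Z. Z \<approx> column B x \<and>
        (\<forall>y\<in>{y. prod_encode (x, y) \<in> N}. y \<in> Z \<longleftrightarrow> y \<in> column A x)"
      then obtain Z where "\<forall>x. Z x \<approx> column B x \<and>
        (\<forall>y\<in>{y. prod_encode (x, y) \<in> N}. y \<in> Z x \<longleftrightarrow> y \<in> column A x)"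
        using choice[of "\<lambda>x Z. Z \<approx> column B x \<and>
          (\<forall>y\<in>{y. prod_encode (x, y) \<in> N}. y \<in> Z \<longleftrightarrow> y \<in> column A x)"] by blast
      then show thesis by (intro thesis[of Z]) auto
    qed
    have "of_columns Z i = A i" if "i \<in> N" for i
    proof -
      obtain x y where xy: "prod_decode i = (x, y)" by fastforce
      then have "i = prod_encode (x, y)" by (metis prod_decode_inverse)
      then show ?thesis using Z(2)[of x y] that by (simp add: of_columns_def column_def)
    qed
    then have "of_columns Z \<in> \<Union>U" using N(2) by blast
    then obtain V where V: "V \<in> U" "of_columns Z \<in> V" by blast
    have "(of_columns Z, B) \<in> eqf" using Z(1) by (simp add: eqf_def)
    moreover have "V \<in> UNIV // eqf" using U(1) V(1) by (auto simp: openin_eqf_space)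
    ultimately have "V = eqf `` {B}"
      using V(2) by (metis Image_singleton_iff equiv_class_eq equiv_eqf quotientE)
    then show "eqf `` {B} \<in> U" using V(1) by simp
  qed
qed

text \<open>Meet and join are minimum and maximum of the sizes in each column. Where
  \<open>C\<close> is nonempty, disjointness empties the columns of \<open>A\<close> and
  \<open>B\<close>, so their maximum is empty and cannot bound \<open>C\<close>.\<close>

lemma distributive_space_eqf: "distributive_space eqf_space"
proof -
  let ?le = "\<lambda>A B. \<forall>x. column A x \<lesssim> column B x"
  have C: "?le C E"
    if ub: "\<And>D. ?le A D \<Longrightarrow> ?le B D \<Longrightarrow> ?le C D"
      and A: "\<And>D E. ?le D A \<Longrightarrow> ?le D C \<Longrightarrow> ?le D E"
      and B: "\<And>D E. ?le D B \<Longrightarrow> ?le D C \<Longrightarrow> ?le D E" for A B C E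
  proof -
    have meet: "column F x = {} \<or> column C x = {}"
      if F: "\<And>D E. ?le D F \<Longrightarrow> ?le D C \<Longrightarrow> ?le D E" for F x
    proof -
      let ?D = "of_columns (\<lambda>x. if column F x \<lesssim> column C x then column F x else column C x)"
      have D: "column ?D y \<lesssim> column F y" "column ?D y \<lesssim> column C y" for y
        by (cases "column F y \<lesssim> column C y"; simp add: not_lepoll_natD)+
      \<comment> \<open>The minimum lies below every \<open>E\<close>; taking all columns of
        \<open>E\<close> empty shows that it is empty itself.\<close>
      have "?le ?D (of_columns (\<lambda>_. {}))" by (rule F; rule allI; rule D)
      then have "column ?D x \<lesssim> column (of_columns (\<lambda>_. {})) x" ..
      then show ?thesis by (simp split: if_splits)
    qed
    have "column C x = {}" for x
    proof (rule ccontr)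
      assume "column C x \<noteq> {}"
      then have AB: "column A x = {}" "column B x = {}"
        using meet[of A x, OF A] meet[of B x, OF B] by blast+
      let ?D = "of_columns (\<lambda>x. if column A x \<lesssim> column B x then column B x else column A x)"
      have D: "column A y \<lesssim> column ?D y" "column B y \<lesssim> column ?D y" for y
        by (cases "column A y \<lesssim> column B y"; simp add: not_lepoll_natD)+
      have "?le C ?D" by (rule ub; rule allI; rule D)
      then have "column C x \<lesssim> column ?D x" ..
      with AB \<open>column C x \<noteq> {}\<close> show False by simp
    qed
    then show ?thesis by simp
  qed
  have top: "topspace eqf_space = range (\<lambda>A. eqf `` {A})"
    by (auto simp: topspace_eqf_space quotient_def)
  show ?thesis
    unfolding distributive_space_def disjoint_points_def least_point_def top
    unfolding ball_simps specializes_eqf_space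
    using C by (intro ballI allI impI) blast
qed

section \<open>The specialization order of \<open>ALG\<^sub>0/\<cong>\<close>\<close>

text \<open>With \<iota> as a parameter, one rational can be followed through several fields; the
  full carrier removes membership conditions.\<close>

locale rat_field = field R for R (structure) +
  fixes \<iota> :: "rat \<Rightarrow> 'a"
  assumes carrier_UNIV [simp]: "carrier R = UNIV"
    and \<iota>_hom: "\<iota> \<in> ring_hom rat_ring R"
begin

lemma \<iota>_add: "\<iota> (x + y) = \<iota> x \<oplus> \<iota> y"
  and \<iota>_mult: "\<iota> (x * y) = \<iota> x \<otimes> \<iota> y"
  and \<iota>_one [simp]: "\<iota> 1 = \<one>"
  using \<iota>_hom by (auto simp: ring_hom_def rat_ring_def)

lemma \<iota>_zero [simp]: "\<iota> 0 = \<zero>"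
  using \<iota>_add[of 0 0] add.l_cancel_one[of "\<iota> 0" "\<iota> 0"] by simp

lemma \<iota>_uminus: "\<iota> (- x) = \<ominus> \<iota> x"
  by (rule minus_equality[symmetric]) (simp_all flip: \<iota>_add)

lemma \<iota>_diff: "\<iota> (x - y) = \<iota> x \<ominus> \<iota> y"
  using \<iota>_add[of x "- y"] by (simp add: \<iota>_uminus minus_eq)

lemma \<iota>_eq_zero_iff [simp]: "\<iota> x = \<zero> \<longleftrightarrow> x = 0"
proof
  assume "\<iota> x = \<zero>"
  then have "\<iota> (x * inverse x) = \<zero>" by (simp add: \<iota>_mult)
  then show "x = 0" by (cases "x = 0") simp_all
qed simp

lemma \<iota>_eq_iff [simp]: "\<iota> x = \<iota> y \<longleftrightarrow> x = y"
proof
  assume "\<iota> x = \<iota> y"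
  then have "\<iota> (x - y) = \<zero>" by (simp add: \<iota>_diff minus_eq r_neg)
  then show "x = y" by simp
qed simp

lemma ring_rat_ring: "ring rat_ring"
proof (intro ringI abelian_groupI monoidI)
  fix x assume "x \<in> carrier rat_ring"
  then show "\<exists>y\<in>carrier rat_ring. y \<oplus>\<^bsub>rat_ring\<^esub> x = \<zero>\<^bsub>rat_ring\<^esub>"
    by (intro bexI[of _ "- x"]) (auto simp: rat_ring_def)
qed (auto simp: rat_ring_def algebra_simps)

lemma subring_range: "subring (range \<iota>) R"
proof -
  interpret \<iota>: ring_hom_ring rat_ring R \<iota>
    using ring_rat_ring is_ring \<iota>_hom by (intro ring_hom_ringI2)
  show ?thesis
    using \<iota>.img_is_subring[OF \<iota>.R.carrier_is_subring] by (simp add: rat_ring_def)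
qed

text \<open>Replaces polynomials over a subring by lists of rationals, leading coefficient first, so
  that the same list can be evaluated in two fields.\<close>

lemma algebraic_over_range_iff:
  "(algebraic over range \<iota>) x \<longleftrightarrow> (\<exists>cs. cs \<noteq> [] \<and> hd cs \<noteq> 0 \<and> eval (map \<iota> cs) x = \<zero>)"
proof
  assume "(algebraic over range \<iota>) x"
  then obtain p where p: "p \<in> carrier ((range \<iota>)[X])" "p \<noteq> []" "eval p x = \<zero>"
    using algebraicE[OF subring_range] by auto
  then have "p \<in> lists (range \<iota>)" "hd p \<noteq> \<zero>"
    by (auto simp: polynomial_def simp flip: univ_poly_carrier)
  then obtain cs where "p = map \<iota> cs"
    by (metis (no_types, lifting) imageE lists_image)
  with p \<open>hd p \<noteq> \<zero>\<close> show "\<exists>cs. cs \<noteq> [] \<and> hd cs \<noteq> 0 \<and> eval (map \<iota> cs) x = \<zero>"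
    by (intro exI[of _ cs]) (auto simp: hd_map)
next
  assume "\<exists>cs. cs \<noteq> [] \<and> hd cs \<noteq> 0 \<and> eval (map \<iota> cs) x = \<zero>"
  then obtain cs where cs: "cs \<noteq> []" "hd cs \<noteq> 0" "eval (map \<iota> cs) x = \<zero>" by blast
  have "map \<iota> cs \<in> carrier ((range \<iota>)[X])"
    using cs(1,2) by (auto simp: polynomial_def hd_map simp flip: univ_poly_carrier)
  then show "(algebraic over range \<iota>) x"
    using cs by (intro algebraicI) auto
qed

text \<open>Leaves only finitely many candidates for the image of an algebraic element.\<close>

lemma finite_roots:
  assumes "cs \<noteq> []" "hd cs \<noteq> 0"
  shows "finite {x. eval (map \<iota> cs) x = \<zero>}"
proof -
  have "map \<iota> cs \<in> carrier (poly_ring R)"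
    using assms by (auto simp: polynomial_def hd_map simp flip: univ_poly_carrier)
  then show ?thesis
    using finite_number_of_roots[of "map \<iota> cs"] assms(1) by (simp add: is_root_def)
qed

end

definition algebraic_rat_field :: "('a, 'b) ring_scheme \<Rightarrow> (rat \<Rightarrow> 'a) \<Rightarrow> bool" where
  "algebraic_rat_field R \<iota> \<longleftrightarrow> rat_field R \<iota> \<and>
    (\<forall>x. \<exists>cs. cs \<noteq> [] \<and> hd cs \<noteq> 0 \<and> ring.eval R (map \<iota> cs) x = \<zero>\<^bsub>R\<^esub>)"

lemma alg_field_iff: "alg_field R \<longleftrightarrow> (\<exists>\<iota>. algebraic_rat_field R \<iota>)"
proof -
  have "alg_field R \<longleftrightarrow> (\<exists>\<iota>. rat_field R \<iota> \<and> (\<forall>x. (ring.algebraic R over range \<iota>) x))"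
    by (auto simp: alg_field_def rat_field_def rat_field_axioms_def)
  also have "\<dots> \<longleftrightarrow> (\<exists>\<iota>. algebraic_rat_field R \<iota>)"
    by (simp add: algebraic_rat_field_def rat_field.algebraic_over_range_iff cong: conj_cong)
  finally show ?thesis .
qed

text \<open>Transport of structure, used to move pairs of rationals onto \<open>nat\<close> and to
  permute the domain of a field on \<open>nat\<close>.\<close>

lemma algebraic_rat_field_image_ring:
  assumes "algebraic_rat_field R \<iota>" "bij f"
  shows "algebraic_rat_field (image_ring f R) (f \<circ> \<iota>)" "f \<in> ring_iso R (image_ring f R)"
proof -
  interpret R: rat_field R \<iota> using assms(1) by (simp add: algebraic_rat_field_def)
  have inj: "inj_on f (carrier R)" and surj: "range f = UNIV"
    using assms(2) by (simp_all add: bij_def)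
  show iso: "f \<in> ring_iso R (image_ring f R)"
    using inj by (rule inj_imp_image_ring_iso)
  have hom: "f \<in> ring_hom R (image_ring f R)"
    using iso by (simp add: ring_iso_def)
  interpret S: field "image_ring f R" by (rule R.inj_imp_image_ring_is_field[OF inj])
  have carrier: "carrier (image_ring f R) = UNIV"
    by (simp add: image_ring_carrier surj)
  interpret f: ring_hom_ring R "image_ring f R" f
    using R.is_ring S.is_ring hom by (intro ring_hom_ringI2)
  have "f \<circ> \<iota> \<in> ring_hom rat_ring (image_ring f R)"
    using R.\<iota>_hom hom by (rule ring_hom_trans)
  then have "rat_field (image_ring f R) (f \<circ> \<iota>)"
    using S.field_axioms carrier by (simp add: rat_field_def rat_field_axioms_def)
  moreover have "\<exists>cs. cs \<noteq> [] \<and> hd cs \<noteq> 0 \<and>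
    S.eval (map (f \<circ> \<iota>) cs) x = \<zero>\<^bsub>image_ring f R\<^esub>" for x
  proof -
    obtain y where y: "x = f y" using surj by blast
    obtain cs where cs: "cs \<noteq> []" "hd cs \<noteq> 0" "R.eval (map \<iota> cs) y = \<zero>\<^bsub>R\<^esub>"
      using assms(1) unfolding algebraic_rat_field_def by blast
    have "S.eval (map f (map \<iota> cs)) (f y) = f \<zero>\<^bsub>R\<^esub>"
      using f.eval_hom'[of y "map \<iota> cs"] cs(3) by simp
    then show ?thesis using cs y by auto
  qed
  ultimately show "algebraic_rat_field (image_ring f R) (f \<circ> \<iota>)"
    unfolding algebraic_rat_field_def by blast
qed

section \<open>Renaming elements in atomic sentences\<close>

primrec rename_term :: "(nat \<Rightarrow> nat) \<Rightarrow> fterm \<Rightarrow> fterm" where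
  "rename_term e Zero = Zero"
| "rename_term e One = One"
| "rename_term e (Elem a) = Elem (e a)"
| "rename_term e (Plus s t) = Plus (rename_term e s) (rename_term e t)"
| "rename_term e (Times s t) = Times (rename_term e s) (rename_term e t)"

primrec rename :: "(nat \<Rightarrow> nat) \<Rightarrow> atomic_sentence \<Rightarrow> atomic_sentence" where
  "rename e (Eq s t) = Eq (rename_term e s) (rename_term e t)"

primrec term_elems :: "fterm \<Rightarrow> nat set" where
  "term_elems Zero = {}"
| "term_elems One = {}"
| "term_elems (Elem a) = {a}"
| "term_elems (Plus s t) = term_elems s \<union> term_elems t"
| "term_elems (Times s t) = term_elems s \<union> term_elems t"

primrec sentence_elems :: "atomic_sentence \<Rightarrow> nat set" where
  "sentence_elems (Eq s t) = term_elems s \<union> term_elems t"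

lemma finite_sentence_elems: "finite (sentence_elems \<phi>)"
proof -
  have "finite (term_elems t)" for t by (induction t) auto
  then show ?thesis by (cases \<phi>) simp
qed

lemma rename_ident: "(\<And>a. a \<in> sentence_elems \<phi> \<Longrightarrow> e a = a) \<Longrightarrow> rename e \<phi> = \<phi>"
proof -
  have "(\<And>a. a \<in> term_elems t \<Longrightarrow> e a = a) \<Longrightarrow> rename_term e t = t" for t
    by (induction t) auto
  then show "(\<And>a. a \<in> sentence_elems \<phi> \<Longrightarrow> e a = a) \<Longrightarrow> rename e \<phi> = \<phi>"
    by (cases \<phi>) simp
qed

text \<open>Term values commute with \<open>h\<close>, and injectivity keeps false equations false.
  The composition allows \<open>h\<close> to follow an earlier renaming \<open>e\<close>.\<close>

lemma holds_rename_hom: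
  assumes "ring R" "ring S" "carrier R = UNIV" "h \<in> ring_hom R S" "inj h"
  shows "holds S (rename (h \<circ> e) \<phi>) \<longleftrightarrow> holds R (rename e \<phi>)"
proof -
  interpret h: ring_hom_ring R S h using assms by (intro ring_hom_ringI2)
  have "term_val S (rename_term (h \<circ> e) t) = h (term_val R (rename_term e t))" for t
    by (induction t) (simp_all add: assms(3))
  then show ?thesis by (cases \<phi>) (simp add: inj_eq[OF assms(5)])
qed

text \<open>The map \<open>e\<close> may depend on \<open>N\<close> and need not be a homomorphism.
  An equivalence is required because neighbourhoods in Cantor space fix negative bits as
  well.\<close>

definition locally_embeds :: "nat ring \<Rightarrow> nat ring \<Rightarrow> bool" where
  "locally_embeds R S \<longleftrightarrow>
    (\<forall>N. finite N \<longrightarrow> (\<exists>e. \<forall>\<phi>\<in>N. holds S (rename e \<phi>) \<longleftrightarrow> holds R \<phi>))"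

lemma locally_embedsE:
  assumes "locally_embeds R S" "finite N"
  obtains e where "\<And>\<phi>. \<phi> \<in> N \<Longrightarrow> holds S (rename e \<phi>) \<longleftrightarrow> holds R \<phi>"
proof -
  obtain e where "\<forall>\<phi>\<in>N. holds S (rename e \<phi>) \<longleftrightarrow> holds R \<phi>"
    using assms unfolding locally_embeds_def by blast
  then show thesis by (intro that[of e]) simp
qed

definition iso_class :: "nat ring \<Rightarrow> (nat \<Rightarrow> bool) set" where
  "iso_class R = ALG0_iso `` {atomic_diagram R}"

lemma openin_ALG0_space:
  "openin ALG0_space U \<longleftrightarrow>
    U \<subseteq> ALG0 // ALG0_iso \<and> (\<exists>W. openin cantor_space W \<and> \<Union>U = W \<inter> ALG0)"
  unfolding ALG0_space_def
  by (simp add: openin_quotient_topology equiv_ALG0_iso openin_subtopology)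

lemma topspace_ALG0_space: "topspace ALG0_space = iso_class ` Collect alg_field"
proof -
  have "topspace ALG0_space = ALG0 // ALG0_iso"
    unfolding ALG0_space_def by (simp add: topspace_quotient_topology equiv_ALG0_iso)
  then show ?thesis by (auto simp: quotient_def iso_class_def ALG0_def)
qed

lemma iso_class_in_topspace: "alg_field R \<Longrightarrow> iso_class R \<in> topspace ALG0_space"
  by (simp add: topspace_ALG0_space)

lemma mem_iso_class_iff:
  assumes "alg_field R" "alg_field S"
  shows "atomic_diagram S \<in> iso_class R \<longleftrightarrow> R \<simeq> S"
proof
  assume "atomic_diagram S \<in> iso_class R"
  then obtain R' S' where *: "atomic_diagram R = atomic_diagram R'"
    "atomic_diagram S = atomic_diagram S'" "alg_field R'" "alg_field S'" "R' \<simeq> S'"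
    by (auto simp: iso_class_def ALG0_iso_def)
  then have "R = R'" "S = S'"
    using assms by (auto simp: alg_field_def intro: atomic_diagram_inj)
  with * show "R \<simeq> S" by simp
qed (use assms in \<open>auto simp: iso_class_def ALG0_iso_def\<close>)

lemma iso_class_eq_iff:
  assumes "alg_field R" "alg_field S"
  shows "iso_class R = iso_class S \<longleftrightarrow> R \<simeq> S"
  using assms eq_equiv_class_iff[OF equiv_ALG0_iso, of "atomic_diagram R" "atomic_diagram S"]
    mem_iso_class_iff[OF assms]
  by (auto simp: iso_class_def ALG0_def)

lemma iso_class_mem: "alg_field R \<Longrightarrow> atomic_diagram R \<in> iso_class R"
  by (simp add: mem_iso_class_iff ring_iso_refl)

lemma alg_field_ring: "alg_field R \<Longrightarrow> ring R" "alg_field R \<Longrightarrow> carrier R = UNIV"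
  by (auto simp: alg_field_def field.is_ring)

lemma inj_extends_to_bij:
  fixes e :: "nat \<Rightarrow> nat"
  assumes "finite A" "inj_on e A"
  shows "\<exists>\<sigma>. bij \<sigma> \<and> (\<forall>a\<in>A. \<sigma> a = e a)"
proof -
  have "\<exists>g. bij_betw g (UNIV :: nat set) (- A)" "\<exists>g. bij_betw g (UNIV :: nat set) (- e ` A)"
    using bij_enumerate[of "- A"] bij_enumerate[of "- e ` A"] assms(1)
    by (auto simp: Compl_eq_Diff_UNIV)
  then obtain g where g: "bij_betw g (- A) (- e ` A)"
    by (meson bij_betw_inv bij_betw_trans)
  have "bij_betw (\<lambda>a. if a \<in> A then e a else g a) (A \<union> - A) (e ` A \<union> - e ` A)"
    using inj_on_imp_bij_betw[OF assms(2)] g by (intro bij_betw_disjoint_Un) auto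
  then show ?thesis
    by (intro exI[of _ "\<lambda>a. if a \<in> A then e a else g a"]) simp
qed

lemma openin_cantor_local: "openin cantor_space {g. \<exists>e\<in>E. \<forall>\<phi>\<in>N. g (k e \<phi>) = b \<phi>}" if "finite N"
  unfolding openin_cantor_space
proof
  fix g assume "g \<in> {g. \<exists>e\<in>E. \<forall>\<phi>\<in>N. g (k e \<phi>) = b \<phi>}"
  then obtain e where "e \<in> E" "\<forall>\<phi>\<in>N. g (k e \<phi>) = b \<phi>" by blast
  then show "\<exists>M. finite M \<and>
    (\<forall>h. (\<forall>i\<in>M. h i = g i) \<longrightarrow> h \<in> {g. \<exists>e\<in>E. \<forall>\<phi>\<in>N. g (k e \<phi>) = b \<phi>})"
    using that by (intro exI[of _ "k e ` N"]) auto
qed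

text \<open>Containing a copy of a finite piece of \<open>R\<close> is an open property invariant
  under isomorphism. Conversely, a neighbourhood of \<open>R\<close> reads only a finite piece; if
  \<open>S\<close> contains a copy of it, relabelling \<open>S\<close> gives an isomorphic field
  inside that neighbourhood.\<close>

lemma specializes_ALG0_space:
  assumes R: "alg_field R" and S: "alg_field S"
  shows "specializes ALG0_space (iso_class R) (iso_class S) \<longleftrightarrow> locally_embeds R S"
proof
  assume *: "specializes ALG0_space (iso_class R) (iso_class S)"
  show "locally_embeds R S"
    unfolding locally_embeds_def
  proof (intro allI impI)
    fix N :: "atomic_sentence set" assume N: "finite N"
    define P where "P T \<longleftrightarrow> (\<exists>e. \<forall>\<phi>\<in>N. holds T (rename e \<phi>) \<longleftrightarrow> holds R \<phi>)" for T
    define W where "W = {g. \<exists>e\<in>UNIV. \<forall>\<phi>\<in>N. g (sentence_code (rename e \<phi>)) = holds R \<phi>}"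
    define U where "U = {iso_class T |T. alg_field T \<and> P T}"
    have W: "atomic_diagram T \<in> W \<longleftrightarrow> P T" for T
      by (simp add: W_def P_def atomic_diagram_sentence_code)
    \<comment> \<open>This makes \<open>W\<close>, restricted to \<open>ALG0\<close>, a union of
      isomorphism classes.\<close>
    have P_iso: "P T'" if T: "alg_field T" "alg_field T'" and iso: "T \<simeq> T'" and P: "P T" for T T'
    proof -
      obtain h where h: "h \<in> ring_iso T T'" using iso by (auto simp: is_ring_iso_def)
      then have "h \<in> ring_hom T T'" "inj h"
        using alg_field_ring[OF T(1)] by (auto simp: ring_iso_def bij_betw_def)
      then have "holds T' (rename (h \<circ> e) \<phi>) \<longleftrightarrow> holds T (rename e \<phi>)" for e \<phi>
        using alg_field_ring T by (intro holds_rename_hom) auto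
      with P show ?thesis unfolding P_def by metis
    qed
    have "\<Union>U = W \<inter> ALG0"
    proof (intro equalityI subsetI)
      fix g assume "g \<in> \<Union>U"
      then obtain T where T: "alg_field T" "P T" "g \<in> iso_class T" by (auto simp: U_def)
      then obtain T' where T': "alg_field T'" "g = atomic_diagram T'"
        by (auto simp: iso_class_def ALG0_iso_def)
      with T P_iso show "g \<in> W \<inter> ALG0"
        by (auto simp: W ALG0_def mem_iso_class_iff)
    next
      fix g assume "g \<in> W \<inter> ALG0"
      then obtain T where "g = atomic_diagram T" "alg_field T" "P T" by (auto simp: ALG0_def W)
      then show "g \<in> \<Union>U" unfolding U_def using iso_class_mem by blast
    qed
    moreover have "openin cantor_space W"
      unfolding W_def using N by (rule openin_cantor_local)
    moreover have "U \<subseteq> ALG0 // ALG0_iso"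
      by (auto simp: U_def iso_class_def ALG0_def intro: quotientI)
    ultimately have "openin ALG0_space U" unfolding openin_ALG0_space by blast
    moreover have "P R" unfolding P_def by (intro exI[of _ id]) (simp add: rename_ident)
    ultimately have "iso_class S \<in> U"
      using * R by (auto simp: specializes_def U_def)
    then obtain T where "alg_field T" "P T" "iso_class S = iso_class T" by (auto simp: U_def)
    then have "P S" using P_iso S by (metis iso_class_eq_iff)
    then show "\<exists>e. \<forall>\<phi>\<in>N. holds S (rename e \<phi>) \<longleftrightarrow> holds R \<phi>" by (simp add: P_def)
  qed
next
  assume *: "locally_embeds R S"
  show "specializes ALG0_space (iso_class R) (iso_class S)"
    unfolding specializes_def
  proof (intro allI impI)
    fix U assume U: "openin ALG0_space U" "iso_class R \<in> U"
    obtain W where W: "openin cantor_space W" "\<Union>U = W \<inter> ALG0"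
      using U(1) by (auto simp: openin_ALG0_space)
    have "atomic_diagram R \<in> W"
      using U(2) W(2) iso_class_mem[OF R] by blast
    with W(1) obtain N where
      N: "finite N" "\<And>h. (\<forall>i\<in>N. h i = atomic_diagram R i) \<Longrightarrow> h \<in> W"
      by (rule openin_cantor_spaceE) blast
    define M where "M = sentence_code -` N"
    define A where "A = (\<Union>\<phi>\<in>M. sentence_elems \<phi>)"
    have "finite M"
      unfolding M_def using N(1) bij_is_inj[OF bij_sentence_code] by (intro finite_vimageI)
    then have "finite A" by (auto simp: A_def finite_sentence_elems)
    \<comment> \<open>The equations between elements of \<open>A\<close> force the renaming to be injective on \<open>A\<close>.\<close>
    with \<open>finite M\<close> have fin: "finite (M \<union> (\<lambda>(a, b). Eq (Elem a) (Elem b)) ` (A \<times> A))" by simp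
    obtain e where
      e: "\<And>\<phi>. \<phi> \<in> M \<union> (\<lambda>(a, b). Eq (Elem a) (Elem b)) ` (A \<times> A) \<Longrightarrow>
        holds S (rename e \<phi>) \<longleftrightarrow> holds R \<phi>"
      using locally_embedsE[OF * fin] by blast
    have "inj_on e A"
    proof (rule inj_onI)
      fix a b assume "a \<in> A" "b \<in> A" "e a = e b"
      then show "a = b"
        using e[OF UnI2, OF imageI, of "(a, b)"] by simp
    qed
    with \<open>finite A\<close> obtain \<sigma> where \<sigma>: "bij \<sigma>" "\<And>a. a \<in> A \<Longrightarrow> \<sigma> a = e a"
      using inj_extends_to_bij by meson
    \<comment> \<open>The inverse permutation gives each copy \<open>e a\<close> the name
      \<open>a\<close> back, so \<open>T\<close> decides the sentences of \<open>M\<close> as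
      \<open>R\<close> does.\<close>
    define \<pi> where "\<pi> = Hilbert_Choice.inv \<sigma>"
    have \<pi>: "bij \<pi>" "\<And>a. a \<in> A \<Longrightarrow> \<pi> (e a) = a"
      using \<sigma> by (simp_all add: \<pi>_def bij_imp_bij_inv) (metis bij_inv_eq_iff)
    define T where "T = image_ring \<pi> S"
    obtain \<iota> where "algebraic_rat_field S \<iota>" using S alg_field_iff by blast
    then have T: "alg_field T" "\<pi> \<in> ring_iso S T"
      using algebraic_rat_field_image_ring[OF _ \<pi>(1)] alg_field_iff unfolding T_def by blast+
    have "atomic_diagram T i = atomic_diagram R i" if "i \<in> N" for i
    proof -
      obtain \<phi> where \<phi>: "i = sentence_code \<phi>" using bij_sentence_code by (metis bij_pointE)
      then have "\<phi> \<in> M" using that by (simp add: M_def)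
      then have "rename (\<pi> \<circ> e) \<phi> = \<phi>" using \<pi>(2) by (intro rename_ident) (auto simp: A_def)
      moreover have "holds T (rename (\<pi> \<circ> e) \<phi>) \<longleftrightarrow> holds S (rename e \<phi>)"
        using T S alg_field_ring \<pi>(1)
        by (intro holds_rename_hom) (auto simp: ring_iso_def bij_is_inj)
      ultimately show ?thesis
        using e[of \<phi>] \<open>\<phi> \<in> M\<close> by (simp add: \<phi> atomic_diagram_sentence_code)
    qed
    then have "atomic_diagram T \<in> \<Union>U"
      unfolding W(2) using N(2) T(1) by (auto simp: ALG0_def)
    then obtain V where V: "V \<in> U" "atomic_diagram T \<in> V" by blast
    then have "V \<in> topspace ALG0_space" using U(1) openin_subset by blast
    then obtain V' where V': "alg_field V'" "V = iso_class V'"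
      by (auto simp: topspace_ALG0_space)
    then have "V = iso_class T" using V(2) T(1) by (simp add: mem_iso_class_iff iso_class_eq_iff)
    also have "\<dots> = iso_class S"
      using S T by (metis iso_class_eq_iff is_ring_iso_def empty_iff)
    finally show "iso_class S \<in> U" using V(1) by simp
  qed
qed

section \<open>Quadratic fields\<close>

primrec numeral_term :: "nat \<Rightarrow> fterm" where
  "numeral_term 0 = Zero"
| "numeral_term (Suc k) = Plus (numeral_term k) One"

text \<open>For \<open>r = a / b\<close> the sentence says \<open>b x + a\<^sup>- = a\<^sup>+\<close>, with all coefficients natural numbers, as the
  language has no subtraction.\<close>

definition rat_sentence :: "rat \<Rightarrow> nat \<Rightarrow> atomic_sentence" where
  "rat_sentence r x = (case quotient_of r of (a, b) \<Rightarrow>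
    Eq (Plus (Times (numeral_term (nat b)) (Elem x)) (numeral_term (nat (- a))))
       (numeral_term (nat a)))"

primrec power_term :: "nat \<Rightarrow> nat \<Rightarrow> fterm" where
  "power_term x 0 = One"
| "power_term x (Suc k) = Times (power_term x k) (Elem x)"

primrec poly_term :: "nat list \<Rightarrow> nat \<Rightarrow> fterm" where
  "poly_term [] x = Zero"
| "poly_term (c # cs) x = Plus (Times (Elem c) (power_term x (length cs))) (poly_term cs x)"

lemma rename_numeral_term [simp]: "rename_term e (numeral_term k) = numeral_term k"
  by (induction k) auto

lemma rename_rat_sentence [simp]: "rename e (rat_sentence r x) = rat_sentence r (e x)"
  by (simp add: rat_sentence_def split: prod.split)

lemma rename_poly_term [simp]: "rename_term e (poly_term cs x) = poly_term (map e cs) (e x)"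
proof -
  have "rename_term e (power_term x k) = power_term (e x) k" for k by (induction k) auto
  then show ?thesis by (induction cs) auto
qed

context
  fixes R :: "nat ring" and \<iota> :: "rat \<Rightarrow> nat"
  assumes R: "rat_field R \<iota>"
begin

interpretation rat_field R \<iota> by (rule R)

lemma term_val_numeral_term: "term_val R (numeral_term k) = \<iota> (of_nat k)"
  by (induction k) (simp_all add: \<iota>_add a_comm)

text \<open>The linear equation has a unique solution because the denominator is nonzero in
  \<open>R\<close>. Since \<open>x\<close> is the only element named, a renaming that preserves the
  sentence sends a rational to the same rational.\<close>

lemma holds_rat_sentence_iff: "holds R (rat_sentence r x) \<longleftrightarrow> x = \<iota> r"
proof -
  obtain a b where ab: "quotient_of r = (a, b)" by fastforce
  then have "b > 0" "r = of_int a / of_int b"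
    by (simp_all add: quotient_of_denom_pos quotient_of_div)
  define k where "k = (of_nat (nat b) :: rat)"
  have "k \<noteq> 0" "k * r + of_nat (nat (- a)) = of_nat (nat a)"
    using \<open>b > 0\<close> \<open>r = _\<close> by (simp_all add: k_def of_nat_nat)
  then have "\<iota> k \<otimes>\<^bsub>R\<^esub> \<iota> r \<oplus>\<^bsub>R\<^esub> \<iota> (of_nat (nat (- a))) = \<iota> (of_nat (nat a))"
    by (metis \<iota>_add \<iota>_mult)
  then have "holds R (rat_sentence r x) \<longleftrightarrow> \<iota> k \<otimes>\<^bsub>R\<^esub> x \<oplus>\<^bsub>R\<^esub> \<iota> (of_nat (nat (- a))) =
    \<iota> k \<otimes>\<^bsub>R\<^esub> \<iota> r \<oplus>\<^bsub>R\<^esub> \<iota> (of_nat (nat (- a)))"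
    by (simp add: rat_sentence_def ab term_val_numeral_term k_def)
  also have "\<dots> \<longleftrightarrow> \<iota> k \<otimes>\<^bsub>R\<^esub> x = \<iota> k \<otimes>\<^bsub>R\<^esub> \<iota> r" by simp
  also have "\<dots> \<longleftrightarrow> x = \<iota> r" using \<open>k \<noteq> 0\<close> by (simp add: m_lcancel)
  finally show ?thesis .
qed

lemma term_val_poly_term: "term_val R (poly_term cs x) = ring.eval R cs x"
proof -
  have "term_val R (power_term x k) = x [^]\<^bsub>R\<^esub> k" for k
    by (induction k) simp_all
  then show ?thesis by (induction cs) simp_all
qed

end

definition quadratic_generator ::
    "('a, 'b) ring_scheme \<Rightarrow> (rat \<Rightarrow> 'a) \<Rightarrow> rat \<Rightarrow> 'a \<Rightarrow> bool" where
  "quadratic_generator R \<iota> n s \<longleftrightarrow> s \<otimes>\<^bsub>R\<^esub> s = \<iota> n \<and> (\<forall>x. \<exists>p q. x = \<iota> p \<oplus>\<^bsub>R\<^esub> \<iota> q \<otimes>\<^bsub>R\<^esub> s)"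

text \<open>A local embedding may send \<open>y\<close> anywhere, but a polynomial annihilating \<open>y\<close> leaves only finitely
  many possible images \<open>p + q s\<close>.  If \<open>y\<close> satisfied none of the corresponding equations
  \<open>(y - p)\<^sup>2 = n q\<^sup>2\<close>, this would be a further finite set of facts to be preserved.\<close>

lemma locally_embeds_quadratic:
  assumes R: "algebraic_rat_field R \<iota>" and S: "rat_field S \<kappa>"
    and s: "quadratic_generator S \<kappa> n s" and emb: "locally_embeds R S"
  shows "\<exists>p q. (y \<oplus>\<^bsub>R\<^esub> \<iota> (- p)) \<otimes>\<^bsub>R\<^esub> (y \<oplus>\<^bsub>R\<^esub> \<iota> (- p)) = \<iota> (n * q * q)"
proof -
  interpret R: rat_field R \<iota> using R by (simp add: algebraic_rat_field_def)
  interpret S: rat_field S \<kappa> by (rule S)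
  obtain cs where cs: "cs \<noteq> []" "hd cs \<noteq> 0" "R.eval (map \<iota> cs) y = \<zero>\<^bsub>R\<^esub>"
    using R unfolding algebraic_rat_field_def by blast
  define Z where "Z = {z. S.eval (map \<kappa> cs) z = \<zero>\<^bsub>S\<^esub>}"
  have "finite Z" unfolding Z_def by (rule S.finite_roots[OF cs(1,2)])
  have "\<forall>z. \<exists>p q. z = \<kappa> p \<oplus>\<^bsub>S\<^esub> \<kappa> q \<otimes>\<^bsub>S\<^esub> s"
    using s by (simp add: quadratic_generator_def)
  then obtain P Q where PQ: "\<And>z. z = \<kappa> (P z) \<oplus>\<^bsub>S\<^esub> \<kappa> (Q z) \<otimes>\<^bsub>S\<^esub> s"
    by (auto dest!: choice)
  define q where "q z = n * Q z * Q z" for z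
  \<comment> \<open>All rationals whose images must be controlled: the coefficients, and both
    constants of the equation for each candidate root.\<close>
  define rs where "rs = set cs \<union> (\<lambda>z. - P z) ` Z \<union> q ` Z"
  define \<phi> where "\<phi> z =
    (let t = Plus (Elem y) (Elem (\<iota> (- P z))) in Eq (Times t t) (Elem (\<iota> (q z))))" for z
  \<comment> \<open>\<open>N\<close> is fixed before \<open>e\<close> is known, so it has to contain
    \<phi> for every possible value of \<open>e y\<close>.\<close>
  define N where "N = {Eq (poly_term (map \<iota> cs) y) Zero} \<union>
    (\<lambda>r. rat_sentence r (\<iota> r)) ` rs \<union> \<phi> ` Z"
  have "finite N" using \<open>finite Z\<close> by (simp add: N_def rs_def)
  then obtain e where e: "\<And>\<psi>. \<psi> \<in> N \<Longrightarrow> holds S (rename e \<psi>) \<longleftrightarrow> holds R \<psi>"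
    using locally_embedsE[OF emb] by blast
  have rat: "e (\<iota> r) = \<kappa> r" if "r \<in> rs" for r
  proof -
    have "holds R (rat_sentence r (\<iota> r))"
      by (simp add: holds_rat_sentence_iff[OF R.rat_field_axioms])
    then have "holds S (rat_sentence r (e (\<iota> r)))"
      using e[of "rat_sentence r (\<iota> r)"] that by (simp add: N_def)
    then show ?thesis by (simp add: holds_rat_sentence_iff[OF S])
  qed
  have "map e (map \<iota> cs) = map \<kappa> cs" using rat by (simp add: rs_def)
  then have ren: "rename e (Eq (poly_term (map \<iota> cs) y) Zero) = Eq (poly_term (map \<kappa> cs) (e y)) Zero"
    by (simp only: rename.simps rename_poly_term rename_term.simps)
  have "holds R (Eq (poly_term (map \<iota> cs) y) Zero)"
    using cs(3) by (simp add: term_val_poly_term[OF R.rat_field_axioms])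
  then have "holds S (Eq (poly_term (map \<kappa> cs) (e y)) Zero)"
    using e[of "Eq (poly_term (map \<iota> cs) y) Zero"] by (simp only: ren N_def) simp
  then have Z: "e y \<in> Z"
    by (simp add: Z_def term_val_poly_term[OF S])
  then have rs: "- P (e y) \<in> rs" "q (e y) \<in> rs" by (auto simp: rs_def)
  have "e y \<oplus>\<^bsub>S\<^esub> \<kappa> (- P (e y)) = \<kappa> (Q (e y)) \<otimes>\<^bsub>S\<^esub> s"
  proof -
    have "(\<kappa> (P (e y)) \<oplus>\<^bsub>S\<^esub> \<kappa> (Q (e y)) \<otimes>\<^bsub>S\<^esub> s) \<oplus>\<^bsub>S\<^esub> \<ominus>\<^bsub>S\<^esub> \<kappa> (P (e y)) =
      \<kappa> (Q (e y)) \<otimes>\<^bsub>S\<^esub> s"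
      by (simp add: S.a_ac S.r_neg2)
    then show ?thesis using PQ[of "e y"] by (simp add: S.\<iota>_uminus)
  qed
  moreover have "(\<kappa> (Q (e y)) \<otimes>\<^bsub>S\<^esub> s) \<otimes>\<^bsub>S\<^esub> (\<kappa> (Q (e y)) \<otimes>\<^bsub>S\<^esub> s) = \<kappa> (q (e y))"
  proof -
    have "(\<kappa> (Q (e y)) \<otimes>\<^bsub>S\<^esub> s) \<otimes>\<^bsub>S\<^esub> (\<kappa> (Q (e y)) \<otimes>\<^bsub>S\<^esub> s) =
      (s \<otimes>\<^bsub>S\<^esub> s) \<otimes>\<^bsub>S\<^esub> \<kappa> (Q (e y)) \<otimes>\<^bsub>S\<^esub> \<kappa> (Q (e y))"
      by (simp add: S.m_ac)
    then show ?thesis using s by (simp add: quadratic_generator_def q_def S.\<iota>_mult)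
  qed
  \<comment> \<open>The candidate \<open>z = e y\<close> satisfies its own equation in
    \<open>S\<close>, and \<open>e\<close> reflects this equation back to \<open>y\<close> in
    \<open>R\<close>.\<close>
  ultimately have "holds S (rename e (\<phi> (e y)))"
    by (simp add: \<phi>_def Let_def rat rs)
  then have "holds R (\<phi> (e y))" using e Z by (simp add: N_def)
  then show ?thesis by (auto simp: \<phi>_def Let_def q_def)
qed

text \<open>With \<open>u = y - p\<close> and \<open>d = p - p'\<close>, subtracting the two
  equations leaves \<open>2 d u = b - a - d^2\<close>. This gives a rational \<open>u\<close> if
  \<open>d\<close> is nonzero; otherwise \<open>a = b\<close>, so \<open>a = 0\<close> and
  \<open>u = 0\<close>.\<close>

lemma (in rat_field) rational_if_quadratic_twice:
  assumes p: "(y \<oplus> \<iota> (- p)) \<otimes> (y \<oplus> \<iota> (- p)) = \<iota> a"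
    and p': "(y \<oplus> \<iota> (- p')) \<otimes> (y \<oplus> \<iota> (- p')) = \<iota> b"
    and ab: "a = b \<Longrightarrow> a = 0"
  shows "y \<in> range \<iota>"
proof -
  have cancel: "v = w" if "x \<oplus> (v \<oplus> z) = x \<oplus> (w \<oplus> z)" for v w x z
    using that add.l_cancel[of x "v \<oplus> z" "w \<oplus> z"] add.r_cancel[of v z w] by simp
  define u where "u = y \<oplus> \<iota> (- p)"
  define d where "d = p - p'"
  have y: "y = u \<oplus> \<iota> p" by (simp add: u_def \<iota>_uminus a_assoc l_neg)
  have "y \<oplus> \<iota> (- p') = u \<oplus> \<iota> d"
    unfolding y d_def by (simp add: a_assoc flip: \<iota>_add)
  then have "(u \<oplus> \<iota> d) \<otimes> (u \<oplus> \<iota> d) = \<iota> b" using p' by simp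
  moreover have "(u \<oplus> \<iota> d) \<otimes> (u \<oplus> \<iota> d) = u \<otimes> u \<oplus> ((\<iota> d \<oplus> \<iota> d) \<otimes> u \<oplus> \<iota> d \<otimes> \<iota> d)"
    by (simp add: l_distr r_distr m_ac a_ac)
  moreover have uu: "u \<otimes> u = \<iota> a" using p by (simp add: u_def)
  ultimately have *: "\<iota> a \<oplus> (\<iota> (d + d) \<otimes> u \<oplus> \<iota> (d * d)) = \<iota> b"
    unfolding \<iota>_add \<iota>_mult by simp
  show ?thesis
  proof (cases "d = 0")
    case True
    with * have "a = b" by simp
    with ab uu have "u = \<zero>" using integral by auto
    with y show ?thesis by simp
  next
    case False
    have "\<iota> a \<oplus> (\<iota> (d + d) \<otimes> \<iota> ((b - a - d * d) / (d + d)) \<oplus> \<iota> (d * d)) = \<iota> b"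
      using False by (simp flip: \<iota>_add \<iota>_mult)
    with * have "\<iota> a \<oplus> (\<iota> (d + d) \<otimes> u \<oplus> \<iota> (d * d)) =
        \<iota> a \<oplus> (\<iota> (d + d) \<otimes> \<iota> ((b - a - d * d) / (d + d)) \<oplus> \<iota> (d * d))"
      by (rule trans[OF _ sym])
    then have "\<iota> (d + d) \<otimes> u = \<iota> (d + d) \<otimes> \<iota> ((b - a - d * d) / (d + d))"
      by (rule cancel)
    then have "u = \<iota> ((b - a - d * d) / (d + d))"
      using False by (simp add: m_lcancel)
    with y show ?thesis by (simp flip: \<iota>_add)
  qed
qed

section \<open>Pairs of rationals as a model of Q(sqrt n), with \<open>(p, q)\<close> for p + q sqrt
  n\<close>

definition quad_ring :: "rat \<Rightarrow> (rat \<times> rat) ring" where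
  "quad_ring n = \<lparr>carrier = UNIV,
    mult = (\<lambda>(p, q) (p', q'). (p * p' + n * q * q', p * q' + q * p')), one = (1, 0),
    zero = (0, 0), add = (\<lambda>(p, q) (p', q'). (p + p', q + q'))\<rparr>"

lemma carrier_quad_ring: "carrier (quad_ring n) = UNIV"
  by (simp add: quad_ring_def)

lemma field_quad_ring:
  assumes n: "\<And>q. q * q \<noteq> n"
  shows "field (quad_ring n)"
proof -
  have "cring (quad_ring n)"
  proof (intro cringI abelian_groupI comm_monoidI)
    fix x assume "x \<in> carrier (quad_ring n)"
    show "\<exists>y\<in>carrier (quad_ring n). y \<oplus>\<^bsub>quad_ring n\<^esub> x = \<zero>\<^bsub>quad_ring n\<^esub>"
      by (intro bexI[of _ "(- fst x, - snd x)"]) (auto simp: quad_ring_def split: prod.split)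
  qed (auto simp: quad_ring_def algebra_simps split: prod.splits)
  moreover have "\<exists>y\<in>carrier (quad_ring n). x \<otimes>\<^bsub>quad_ring n\<^esub> y = \<one>\<^bsub>quad_ring n\<^esub>"
    if "x \<noteq> \<zero>\<^bsub>quad_ring n\<^esub>" for x
  proof -
    obtain p q where x: "x = (p, q)" by fastforce
    \<comment> \<open>The norm; it vanishes only at zero as \<open>n\<close> is no square, and the
      inverse is the conjugate divided by it.\<close>
    define d where "d = p * p - n * q * q"
    have "d \<noteq> 0"
    proof
      assume "d = 0"
      then have "q \<noteq> 0" using that x by (auto simp: d_def quad_ring_def)
      then have "(p / q) * (p / q) = n" using \<open>d = 0\<close> by (simp add: d_def field_simps)
      with n show False by blast
    qed
    then show ?thesis
      by (intro bexI[of _ "(p / d, - q / d)"])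
        (auto simp: x quad_ring_def d_def diff_divide_distrib[symmetric])
  qed
  ultimately show ?thesis
    by (intro cring.cring_fieldI2) (auto simp: quad_ring_def)
qed

lemma rat_field_quad_ring:
  assumes "\<And>q. q * q \<noteq> n"
  shows "rat_field (quad_ring n) (\<lambda>p. (p, 0))"
  using field_quad_ring[OF assms]
  by (auto simp: rat_field_def rat_field_axioms_def ring_hom_def rat_ring_def quad_ring_def)

lemma quadratic_generator_quad_ring: "quadratic_generator (quad_ring n) (\<lambda>p. (p, 0)) n (0, 1)"
  by (auto simp: quadratic_generator_def quad_ring_def)

text \<open>The characteristic polynomial, with trace \<open>2 p\<close> and norm
  \<open>p^2 - n q^2\<close>, bracketed in the way \<open>eval\<close> unfolds.\<close>

lemma quad_ring_root:
  "(1, 0) \<otimes>\<^bsub>quad_ring n\<^esub> ((p, q) \<otimes>\<^bsub>quad_ring n\<^esub> (p, q)) \<oplus>\<^bsub>quad_ring n\<^esub>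
    ((- 2 * p, 0) \<otimes>\<^bsub>quad_ring n\<^esub> (p, q) \<oplus>\<^bsub>quad_ring n\<^esub> (p * p - n * q * q, 0)) = \<zero>\<^bsub>quad_ring n\<^esub>"
  by (simp add: quad_ring_def algebra_simps)

lemma algebraic_quad_ring:
  assumes "\<And>q. q * q \<noteq> n"
  shows "algebraic_rat_field (quad_ring n) (\<lambda>p. (p, 0))"
proof -
  interpret rat_field "quad_ring n" "\<lambda>p. (p, 0)" by (rule rat_field_quad_ring[OF assms])
  have "\<exists>cs. cs \<noteq> [] \<and> hd cs \<noteq> 0 \<and> eval (map (\<lambda>p. (p, 0)) cs) x = \<zero>\<^bsub>quad_ring n\<^esub>" for x
  proof -
    obtain p q where x: "x = (p, q)" by fastforce
    define a b where "a = - 2 * p" and "b = p * p - n * q * q"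
    have "eval [a1, a2, a3] x = a1 \<otimes>\<^bsub>quad_ring n\<^esub> (x \<otimes>\<^bsub>quad_ring n\<^esub> x) \<oplus>\<^bsub>quad_ring n\<^esub>
      (a2 \<otimes>\<^bsub>quad_ring n\<^esub> x \<oplus>\<^bsub>quad_ring n\<^esub> a3)" for a1 a2 a3
      by simp
    also have "(1, 0) \<otimes>\<^bsub>quad_ring n\<^esub> (x \<otimes>\<^bsub>quad_ring n\<^esub> x) \<oplus>\<^bsub>quad_ring n\<^esub>
      ((a, 0) \<otimes>\<^bsub>quad_ring n\<^esub> x \<oplus>\<^bsub>quad_ring n\<^esub> (b, 0)) = \<zero>\<^bsub>quad_ring n\<^esub>"
      unfolding x a_def b_def by (rule quad_ring_root)
    finally have "eval (map (\<lambda>p. (p, 0)) [1, a, b]) x = \<zero>\<^bsub>quad_ring n\<^esub>"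
      by (simp only: list.map)
    then show ?thesis by (intro exI[of _ "[1, a, b]"]) simp
  qed
  then show ?thesis
    using rat_field_axioms by (simp add: algebraic_rat_field_def)
qed

text \<open>Substitutes \<open>t\<close> for the square root of \<open>n\<close>; products reduce
  through \<open>t * t\<close> alone.\<close>

lemma quad_ring_hom:
  assumes "rat_field S \<kappa>" "t \<otimes>\<^bsub>S\<^esub> t = \<kappa> n"
  shows "(\<lambda>(p, q). \<kappa> p \<oplus>\<^bsub>S\<^esub> \<kappa> q \<otimes>\<^bsub>S\<^esub> t) \<in> ring_hom (quad_ring n) S"
proof -
  interpret S: rat_field S \<kappa> by (rule assms(1))
  have "(P \<oplus>\<^bsub>S\<^esub> Q \<otimes>\<^bsub>S\<^esub> t) \<otimes>\<^bsub>S\<^esub> (P' \<oplus>\<^bsub>S\<^esub> Q' \<otimes>\<^bsub>S\<^esub> t) =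
    (P \<otimes>\<^bsub>S\<^esub> P' \<oplus>\<^bsub>S\<^esub> (t \<otimes>\<^bsub>S\<^esub> t) \<otimes>\<^bsub>S\<^esub> Q \<otimes>\<^bsub>S\<^esub> Q') \<oplus>\<^bsub>S\<^esub> (P \<otimes>\<^bsub>S\<^esub> Q' \<oplus>\<^bsub>S\<^esub> Q \<otimes>\<^bsub>S\<^esub> P') \<otimes>\<^bsub>S\<^esub> t"
    for P Q P' Q' by (simp add: S.l_distr S.r_distr S.m_ac S.a_ac)
  moreover have "(P \<oplus>\<^bsub>S\<^esub> P') \<oplus>\<^bsub>S\<^esub> (Q \<oplus>\<^bsub>S\<^esub> Q') \<otimes>\<^bsub>S\<^esub> t =
    (P \<oplus>\<^bsub>S\<^esub> Q \<otimes>\<^bsub>S\<^esub> t) \<oplus>\<^bsub>S\<^esub> (P' \<oplus>\<^bsub>S\<^esub> Q' \<otimes>\<^bsub>S\<^esub> t)"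
    for P Q P' Q' by (simp add: S.l_distr S.r_distr S.m_ac S.a_ac)
  ultimately show ?thesis
    by (auto simp: ring_hom_def quad_ring_def S.\<iota>_add S.\<iota>_mult assms(2))
qed

lemma inj_ring_hom_field:
  assumes "field R" "field S" "carrier R = UNIV" "h \<in> ring_hom R S"
  shows "inj h"
  using non_trivial_field_hom_is_inj[of h R S] assms by simp

lemma locally_embeds_if_hom:
  assumes "alg_field R" "alg_field S" "h \<in> ring_hom R S"
  shows "locally_embeds R S"
proof -
  have "inj h" using assms by (intro inj_ring_hom_field) (auto simp: alg_field_def)
  then have "holds S (rename (h \<circ> id) \<phi>) \<longleftrightarrow> holds R (rename id \<phi>)" for \<phi>
    using assms alg_field_ring by (intro holds_rename_hom) auto
  then show ?thesis
    unfolding locally_embeds_def by (metis comp_id id_apply rename_ident)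
qed

text \<open>Two sentences suffice: one pins down the image of \<open>n\<close>, the other makes the
  image of \<open>s\<close> a root of it.\<close>

lemma locally_embeds_square:
  assumes "rat_field R \<iota>" "rat_field S \<kappa>" "locally_embeds R S" "s \<otimes>\<^bsub>R\<^esub> s = \<iota> n"
  shows "\<exists>t. t \<otimes>\<^bsub>S\<^esub> t = \<kappa> n"
proof -
  let ?N = "{rat_sentence n (\<iota> n), Eq (Times (Elem s) (Elem s)) (Elem (\<iota> n))}"
  obtain e where e: "\<And>\<phi>. \<phi> \<in> ?N \<Longrightarrow> holds S (rename e \<phi>) \<longleftrightarrow> holds R \<phi>"
    using locally_embedsE[OF assms(3), of ?N] by blast
  have "e (\<iota> n) = \<kappa> n"
    using e[of "rat_sentence n (\<iota> n)"] assms(1,2) by (simp add: holds_rat_sentence_iff)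
  then show ?thesis
    using e[of "Eq (Times (Elem s) (Elem s)) (Elem (\<iota> n))"] assms(4) by auto
qed

text \<open>Source of least points: a field equal to its copy of Q maps into every other field
  through \<kappa>.\<close>

lemma locally_embeds_if_rational:
  assumes R: "alg_field R" "rat_field R \<iota>" "range \<iota> = UNIV" and S: "alg_field S"
  shows "locally_embeds R S"
proof -
  interpret R: rat_field R \<iota> by (rule R)
  obtain \<kappa> where "rat_field S \<kappa>" using S by (auto simp: alg_field_iff algebraic_rat_field_def)
  then interpret S: rat_field S \<kappa> .
  have "bij \<iota>" using R(3) by (simp add: bij_def inj_def)
  have "\<kappa> \<circ> Hilbert_Choice.inv \<iota> \<in> ring_hom R S"
  proof (rule ring_hom_memI)
    fix x y
    obtain p q where "x = \<iota> p" "y = \<iota> q" using R(3) by (metis rangeE UNIV_I)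
    moreover have "Hilbert_Choice.inv \<iota> (\<iota> r) = r" for r using \<open>bij \<iota>\<close> by (simp add: bij_is_inj)
    ultimately show "(\<kappa> \<circ> Hilbert_Choice.inv \<iota>) (x \<otimes>\<^bsub>R\<^esub> y) =
        (\<kappa> \<circ> Hilbert_Choice.inv \<iota>) x \<otimes>\<^bsub>S\<^esub> (\<kappa> \<circ> Hilbert_Choice.inv \<iota>) y"
      "(\<kappa> \<circ> Hilbert_Choice.inv \<iota>) (x \<oplus>\<^bsub>R\<^esub> y) =
        (\<kappa> \<circ> Hilbert_Choice.inv \<iota>) x \<oplus>\<^bsub>S\<^esub> (\<kappa> \<circ> Hilbert_Choice.inv \<iota>) y"
      by (simp_all add: S.\<iota>_add S.\<iota>_mult flip: R.\<iota>_add R.\<iota>_mult)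
  next
    show "(\<kappa> \<circ> Hilbert_Choice.inv \<iota>) \<one>\<^bsub>R\<^esub> = \<one>\<^bsub>S\<^esub>"
      using \<open>bij \<iota>\<close> by (simp add: bij_is_inj flip: R.\<iota>_one)
  qed simp
  with R(1) S show ?thesis by (rule locally_embeds_if_hom)
qed

text \<open>Copies \<open>quad_ring n\<close> onto \<open>nat\<close>. The last clause is its
  universal property: a root of \<open>n\<close> in \<open>S\<close> yields a homomorphism into
  \<open>S\<close>.\<close>

lemma quadratic_field_exists:
  assumes n: "\<And>q. q * q \<noteq> n"
  obtains R :: "nat ring" and \<iota> s where "alg_field R" "rat_field R \<iota>" "quadratic_generator R \<iota> n s"
    "\<And>S \<kappa> t. alg_field S \<Longrightarrow> rat_field S \<kappa> \<Longrightarrow> t \<otimes>\<^bsub>S\<^esub> t = \<kappa> n \<Longrightarrow> locally_embeds R S"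
proof -
  obtain f :: "rat \<times> rat \<Rightarrow> nat" where f: "bij f"
    using countableE_infinite[of "UNIV :: (rat \<times> rat) set"]
    by (auto simp: finite_prod infinite_UNIV_char_0)
  let ?\<iota> = "\<lambda>p. (p, 0) :: rat \<times> rat"
  define R where "R = image_ring f (quad_ring n)"
  have R: "algebraic_rat_field R (f \<circ> ?\<iota>)" "f \<in> ring_iso (quad_ring n) R"
    unfolding R_def using algebraic_rat_field_image_ring[OF algebraic_quad_ring[OF n] f] by blast+
  have hom: "f (x \<otimes>\<^bsub>quad_ring n\<^esub> y) = f x \<otimes>\<^bsub>R\<^esub> f y" "f (x \<oplus>\<^bsub>quad_ring n\<^esub> y) = f x \<oplus>\<^bsub>R\<^esub> f y"
    for x y
    using R(2) ring_hom_mult[of f "quad_ring n" R x y] ring_hom_add[of f "quad_ring n" R x y]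
    by (simp_all add: ring_iso_def carrier_quad_ring)
  show thesis
  proof (rule that[of R "f \<circ> ?\<iota>" "f (0, 1)"])
    show alg: "alg_field R" using R(1) alg_field_iff by blast
    show "rat_field R (f \<circ> ?\<iota>)" using R(1) by (simp add: algebraic_rat_field_def)
    show "quadratic_generator R (f \<circ> ?\<iota>) n (f (0, 1))"
      unfolding quadratic_generator_def
    proof (intro conjI allI)
      show "f (0, 1) \<otimes>\<^bsub>R\<^esub> f (0, 1) = (f \<circ> ?\<iota>) n"
        using quadratic_generator_quad_ring[of n] by (simp add: quadratic_generator_def flip: hom)
      fix x
      obtain y where "x = f y" using f by (metis bij_pointE)
      moreover obtain p q where "y = ?\<iota> p \<oplus>\<^bsub>quad_ring n\<^esub> ?\<iota> q \<otimes>\<^bsub>quad_ring n\<^esub> (0, 1)"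
        using quadratic_generator_quad_ring[of n] unfolding quadratic_generator_def by blast
      ultimately show "\<exists>p q. x = (f \<circ> ?\<iota>) p \<oplus>\<^bsub>R\<^esub> (f \<circ> ?\<iota>) q \<otimes>\<^bsub>R\<^esub> f (0, 1)"
        by (auto simp flip: hom)
    qed
    fix S \<kappa> t assume S: "alg_field S" "rat_field S \<kappa>" "t \<otimes>\<^bsub>S\<^esub> t = \<kappa> n"
    have "Hilbert_Choice.inv f \<in> ring_iso R (quad_ring n)"
      unfolding R_def using bij_is_inj[OF f] by (rule inj_imp_image_ring_inv_iso)
    then have "Hilbert_Choice.inv f \<in> ring_hom R (quad_ring n)" by (simp add: ring_iso_def)
    from ring_hom_trans[OF this quad_ring_hom[OF S(2,3)]] show "locally_embeds R S"
      using locally_embeds_if_hom[OF alg S(1)] by blast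
  qed
qed

text \<open>For nonzero \<open>n\<close> and \<open>m\<close>, \<open>nm\<close> says that
  \<open>n / m\<close> is not a rational square; its form is that of the degenerate case in
  \<open>rational_if_quadratic_twice\<close>. The second conclusion is kept because the
  counterexample applies it to one of its quadratic fields.\<close>

lemma disjoint_quadratic:
  assumes R: "alg_field R" "rat_field R \<iota>" "quadratic_generator R \<iota> n s"
    and S: "alg_field S" "rat_field S \<kappa>" "quadratic_generator S \<kappa> m t"
    and nm: "\<And>p q. n * p * p = m * q * q \<Longrightarrow> n * p * p = 0"
  shows "disjoint_points ALG0_space (iso_class R) (iso_class S)"
    and "\<And>T \<tau> y. algebraic_rat_field T \<tau> \<Longrightarrow> locally_embeds T R \<Longrightarrow> locally_embeds T S \<Longrightarrow> y \<in> range \<tau>"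
proof -
  show rational: "y \<in> range \<tau>"
    if T: "algebraic_rat_field T \<tau>" "locally_embeds T R" "locally_embeds T S" for T \<tau> y
  proof -
    interpret T: rat_field T \<tau> using T by (simp add: algebraic_rat_field_def)
    obtain p q where "(y \<oplus>\<^bsub>T\<^esub> \<tau> (- p)) \<otimes>\<^bsub>T\<^esub> (y \<oplus>\<^bsub>T\<^esub> \<tau> (- p)) = \<tau> (n * q * q)"
      using locally_embeds_quadratic[OF T(1) R(2,3) T(2)] by blast
    moreover obtain p' q' where "(y \<oplus>\<^bsub>T\<^esub> \<tau> (- p')) \<otimes>\<^bsub>T\<^esub> (y \<oplus>\<^bsub>T\<^esub> \<tau> (- p')) = \<tau> (m * q' * q')"
      using locally_embeds_quadratic[OF T(1) S(2,3) T(3)] by blast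
    ultimately show ?thesis using nm by (rule T.rational_if_quadratic_twice)
  qed
  show "disjoint_points ALG0_space (iso_class R) (iso_class S)"
    unfolding disjoint_points_def least_point_def
  proof (intro ballI impI)
    fix z w
    assume "z \<in> topspace ALG0_space" "w \<in> topspace ALG0_space"
      and zRS: "specializes ALG0_space z (iso_class R) \<and> specializes ALG0_space z (iso_class S)"
    then obtain T U where T: "alg_field T" "z = iso_class T" and U: "alg_field U" "w = iso_class U"
      by (auto simp: topspace_ALG0_space)
    obtain \<tau> where \<tau>: "algebraic_rat_field T \<tau>" using T(1) alg_field_iff by blast
    have "locally_embeds T R" "locally_embeds T S"
      using zRS T R(1) S(1) by (simp_all add: specializes_ALG0_space)
    then have "range \<tau> = UNIV" using rational[OF \<tau>] by blast
    then have "locally_embeds T U"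
      using T U \<tau> by (intro locally_embeds_if_rational) (auto simp: algebraic_rat_field_def)
    then show "specializes ALG0_space z w" using T U by (simp add: specializes_ALG0_space)
  qed
qed

lemma rat_square_neq_2: "q * q \<noteq> (2 :: rat)"
proof
  assume q: "q * q = 2"
  obtain a b where ab: "quotient_of q = (a, b)" by fastforce
  then have "coprime a b" "b > 0" "q = of_int a / of_int b"
    by (simp_all add: quotient_of_coprime quotient_of_denom_pos quotient_of_div)
  then have "of_int a = q * of_int b" by simp
  then have "of_int (a * a) = (q * q) * of_int (b * b)" by (simp add: mult_ac)
  then have "of_int (a * a) = (of_int (2 * b * b) :: rat)" by (simp add: q)
  then have eq: "a * a = 2 * b * b" by (simp only: of_int_eq_iff)
  then have "even (a * a)" by simp
  then have "even a" by simp
  then obtain c where c: "a = 2 * c" by blast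
  with eq have "b * b = 2 * (c * c)" by simp
  then have "even (b * b)" by (metis dvd_triv_left)
  then have "even b" by simp
  with \<open>even a\<close> \<open>coprime a b\<close> show False
    using coprime_common_divisor[of a b 2] by simp
qed

text \<open>The product of roots of -1 and 2 is a root of -2, so \<open>C\<close> lies below all
  common upper bounds of \<open>A\<close> and \<open>B\<close>. It is disjoint from each: from
  \<open>A\<close> because 2 is no square, from \<open>B\<close> by signs.\<close>

lemma not_distributive_space_ALG0: "\<not> distributive_space ALG0_space"
proof
  assume dist: "distributive_space ALG0_space"
  have "q * q \<noteq> r" if "r < 0" for q r :: rat
    using that zero_le_square[of q] by (intro notI) linarith
  then have neg: "q * q \<noteq> - 1" "q * q \<noteq> - 2" for q :: rat by simp_all
  obtain A \<iota> i where A: "alg_field A" "rat_field A \<iota>" "quadratic_generator A \<iota> (- 1) i"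
    by (rule quadratic_field_exists[OF neg(1)]) (rule that; assumption)
  obtain B \<kappa> s where B: "alg_field B" "rat_field B \<kappa>" "quadratic_generator B \<kappa> 2 s"
    by (rule quadratic_field_exists[OF rat_square_neq_2]) (rule that; assumption)
  obtain C \<gamma> t where C: "alg_field C" "rat_field C \<gamma>" "quadratic_generator C \<gamma> (- 2) t"
    and C_emb: "\<And>U \<upsilon> u. alg_field U \<Longrightarrow> rat_field U \<upsilon> \<Longrightarrow> u \<otimes>\<^bsub>U\<^esub> u = \<upsilon> (- 2) \<Longrightarrow> locally_embeds C U"
    by (rule quadratic_field_exists[OF neg(2)]) (rule that; assumption)
  have AC: "- 1 * p * p = 0" if "- 1 * p * p = - 2 * q * q" for p q :: rat
  proof (rule ccontr)
    assume "- 1 * p * p \<noteq> 0"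
    then have "q \<noteq> 0" using that by auto
    then have "(p / q) * (p / q) = 2" using that by (simp add: field_simps)
    then show False using rat_square_neq_2 by blast
  qed
  have BC: "2 * p * p = 0" if "2 * p * p = - 2 * q * q" for p q :: rat
    using that zero_le_square[of p] zero_le_square[of q] by (simp add: algebra_simps)
  have ub: "locally_embeds C U"
    if U: "alg_field U" "locally_embeds A U" "locally_embeds B U" for U
  proof -
    obtain \<upsilon> where "rat_field U \<upsilon>" using U by (auto simp: alg_field_iff algebraic_rat_field_def)
    then interpret U: rat_field U \<upsilon> .
    have "i \<otimes>\<^bsub>A\<^esub> i = \<iota> (- 1)" "s \<otimes>\<^bsub>B\<^esub> s = \<kappa> 2"
      using A(3) B(3) by (simp_all add: quadratic_generator_def)
    then obtain a b where a: "a \<otimes>\<^bsub>U\<^esub> a = \<upsilon> (- 1)" and b: "b \<otimes>\<^bsub>U\<^esub> b = \<upsilon> 2"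
      using locally_embeds_square[OF A(2) U.rat_field_axioms U(2)]
        locally_embeds_square[OF B(2) U.rat_field_axioms U(3)] by blast
    have "(a \<otimes>\<^bsub>U\<^esub> b) \<otimes>\<^bsub>U\<^esub> (a \<otimes>\<^bsub>U\<^esub> b) = (a \<otimes>\<^bsub>U\<^esub> a) \<otimes>\<^bsub>U\<^esub> (b \<otimes>\<^bsub>U\<^esub> b)"
      by (simp add: U.m_ac)
    also have "\<dots> = \<upsilon> (- 2)" by (simp add: a b flip: U.\<iota>_mult)
    finally show ?thesis using C_emb U(1) U.rat_field_axioms by blast
  qed
  note mem = iso_class_in_topspace[OF A(1)] iso_class_in_topspace[OF B(1)] iso_class_in_topspace[OF C(1)]
  have "least_point ALG0_space (iso_class C)"
  proof (rule dist[unfolded distributive_space_def, rule_format, OF mem])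
    show "disjoint_points ALG0_space (iso_class A) (iso_class C)"
      by (rule disjoint_quadratic(1)[OF A C]) (rule AC)
    show "disjoint_points ALG0_space (iso_class B) (iso_class C)"
      by (rule disjoint_quadratic(1)[OF B C]) (rule BC)
    fix u assume u: "u \<in> topspace ALG0_space"
      "specializes ALG0_space (iso_class A) u \<and> specializes ALG0_space (iso_class B) u"
    then obtain U where U: "alg_field U" "u = iso_class U" by (auto simp: topspace_ALG0_space)
    with u(2) have "locally_embeds A U" "locally_embeds B U"
      using A(1) B(1) by (simp_all add: specializes_ALG0_space)
    then have "locally_embeds C U" by (rule ub[OF U(1)])
    then show "specializes ALG0_space (iso_class C) u"
      using C(1) U by (simp add: specializes_ALG0_space)
  qed
  \<comment> \<open>If \<open>C\<close> were least, it would lie below both \<open>A\<close> and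
    itself, so disjointness would make its root of -2 rational.\<close>
  then have "specializes ALG0_space (iso_class C) (iso_class A)"
    using mem(1) unfolding least_point_def by blast
  then have "locally_embeds C A" using A(1) C(1) by (simp add: specializes_ALG0_space)
  have "locally_embeds C C"
    by (rule locally_embeds_if_hom[OF C(1) C(1), of "\<lambda>x. x"]) (simp add: ring_hom_def)
  \<comment> \<open>Algebraicity comes with an embedding \<gamma>' not known to equal \<gamma>. The
    local embedding of \<open>C\<close> into itself transfers the root of -2 without proving them
    equal.\<close>
  obtain \<gamma>' where \<gamma>': "algebraic_rat_field C \<gamma>'" using C(1) alg_field_iff by blast
  interpret C': rat_field C \<gamma>' using \<gamma>' by (simp add: algebraic_rat_field_def)
  have "t \<otimes>\<^bsub>C\<^esub> t = \<gamma> (- 2)" using C(3) by (simp add: quadratic_generator_def)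
  then obtain t' where "t' \<otimes>\<^bsub>C\<^esub> t' = \<gamma>' (- 2)"
    using locally_embeds_square[OF C(2) C'.rat_field_axioms \<open>locally_embeds C C\<close>] by blast
  moreover have "t' \<in> range \<gamma>'"
    by (rule disjoint_quadratic(2)[OF A C _ \<gamma>' \<open>locally_embeds C A\<close> \<open>locally_embeds C C\<close>]) (rule AC)
  then obtain r where "t' = \<gamma>' r" by blast
  ultimately have "\<gamma>' (r * r) = \<gamma>' (- 2)" by (simp add: C'.\<iota>_mult)
  then show False using neg(2) by simp
qed

theorem theorem8p2:
  shows "\<not> scott_topology homeomorphic_space ALG0_space \<and>
         \<not> eqf_space homeomorphic_space ALG0_space"
  using distributive_space_homeomorphic[OF _ distributive_space_scott, of ALG0_space]
    distributive_space_homeomorphic[OF _ distributive_space_eqf, of ALG0_space]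
    not_distributive_space_ALG0 by blast

end
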